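(* Let $A\cong C_0(\Lambda)$ be a separable commutative $C^*$-algebra with Gelfand spectrum $\Lambda$, and let $\pi\colon A\to B(H)$ and $\pi_0\colon A\to B(H_0)$ be nondegenerate representations on separable Hilbert spaces such that $\pi_0$ is asymptotically contained in $\pi$ via a one-parameter unitary group $\{U_t\}$ on $H_0$ and a bounded operator $W\colon H_0\to H$. Suppose that Assumptions A, B, C and D listed in the context hold, with data $\Lambda_0$, $\{H_{0,\lambda}\}$, $\mathfrak{H}_0$, $\mu_0$, $\{U_{t,\lambda}\}$, $\{H_\lambda\}$, $\mathfrak{H}$, $\mu$, $\{C_\lambda\}$. Then the measure $\mu_0$ is absolutely continuous with respect to $\mu$ on the open set $\Lambda_0$, with Radon–Nikodym derivative $$\frac{d\mu_0}{d\mu}(\lambda)=\frac{\operatorname{Trace}(C_\lambda^*C_\lambda)}{\dim(H_{0,\lambda})}.$$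
   Context: Elements of $A$ are viewed as continuous functions on the locally compact space $\Lambda$. Inner products are conjugate-linear in the first variable. Asymptotic containment: $\pi_0$ is asymptotically contained in $\pi$ if (i) there is a one-parameter group of unitary operators $U_t\colon H_0\to H_0$ ($t\in\mathbb{R}$) that commute with the operators in $\pi_0[A]$, and (ii) there is a bounded operator $W\colon H_0\to H$ such that for every $a\in A$ and $u,v\in H_0$, $$\lim_{t\to+\infty}\bigl[\langle u,\pi_0(a)v\rangle_{H_0}-\langle WU_tu,\pi(a)WU_tv\rangle_H\bigr]=0.$$ Assumption A. There are given: (i) an open subset $\Lambda_0\subseteq\Lambda$ and a locally trivial continuous field of finite-dimensional Hilbert spaces $\{H_{0,\lambda}\}_{\lambda\in\Lambda_0}$ (a Hermitian vector bundle over $\Lambda_0$); (ii) a dense subspace $\mathfrak{H}_0\subseteq H_0$ and a linear map $h\mapsto\{h_{0,\lambda}\}$ from $\mathfrak{H}_0$ into the continuous sections of $\{H_{0,\lambda}\}$ such that $H_{0,\lambda}=\{h_{0,\lambda}:h\in\mathfrak{H}_0\}$ for every $\lambda\in\Lambda_0$; (iii) a Borel measure $\mu_0$ on $\Lambda_0$ such that for all $h,g\in\mathfrak{H}_0$ the function $\lambda\mapsto\langle h_{0,\lambda},g_{0,\lambda}\rangle$ is $\mu_0$-integrable and, for every $a\in A$, $\langle h,\pi_0(a)g\rangle_{H_0}=\int_{\Lambda_0}\langle h_{0,\lambda},g_{0,\lambda}\rangle_{H_{0,\lambda}}\,a(\lambda)\,d\mu_0(\lambda)$. Assumption B. Each $U_t$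 maps $\mathfrak{H}_0$ into itself, and the continuous field $\{H_{0,\lambda}\}_{\lambda\in\Lambda_0}$ carries a continuous, unitary (fiberwise) action $\{U_{t,\lambda}\}$ of $\mathbb{R}$ such that $(U_th)_{0,\lambda}=U_{t,\lambda}h_{0,\lambda}$ for every $h\in\mathfrak{H}_0$, $t\in\mathbb{R}$ and $\lambda\in\Lambda_0$. Assumption C. There are given: (i) a locally trivial continuous field of one-dimensional Hilbert spaces $\{H_\lambda\}_{\lambda\in\Lambda}$ (a Hermitian line bundle over $\Lambda$); (ii) a dense subspace $\mathfrak{H}\subseteq H$ such that if $h\in\mathfrak{H}_0$ then $WU_th\in\mathfrak{H}$ for all sufficiently large $t$; (iii) a family of linear maps $\mathfrak{H}\to H_\lambda$, $h\mapsto h_\lambda$, such that $\{h_\lambda\}$ is a continuous section for each $h\in\mathfrak{H}$, and a Borel measure $\mu$ on $\Lambda$ such that for all $h,g\in\mathfrak{H}$ the function $\lambda\mapsto\langle h_\lambda,g_\lambda\rangle$ is $\mu$-integrable and, for every $a\in A$, $\langle h,\pi(a)g\rangle_H=\int_\Lambda\langle h_\lambda,g_\lambda\rangle_{H_\lambda}\,a(\lambda)\,d\mu(\lambda)$. Assumption D. There is given a continuous family of injective linear maps $C_\lambda\colon H_\lambda\to H_{0,\lambda}$ ($\lambda\in\Lambda_0$) such that for every $h\in\mathfrak{H}_0$, every continuous section $\{v_\lambda\}$ of $\{H_\lambda\}$ and every compact $K\subseteq\Lambda_0$, $$\lim_{t\to+\infty}\sup_{\lambda\in K}\bigl|\langle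 C_\lambda v_\lambda,(U_th)_{0,\lambda}\rangle_{H_{0,\lambda}}-\langle v_\lambda,(WU_th)_\lambda\rangle_{H_\lambda}\bigr|=0.$$ *)

theory Defs
  imports "HOL-Analysis.Analysis"
begin

section \<open>Complex vector spaces and Hilbert spaces\<close>

class complex_vector = real_vector +
  fixes scaleC :: "complex \<Rightarrow> 'a \<Rightarrow> 'a"  (infixr \<open>*\<^sub>C\<close> 75)
  assumes scaleC_add_right: "a *\<^sub>C (x + y) = a *\<^sub>C x + a *\<^sub>C y"
    and scaleC_add_left: "(a + b) *\<^sub>C x = a *\<^sub>C x + b *\<^sub>C x"
    and scaleC_scaleC: "a *\<^sub>C b *\<^sub>C x = (a * b) *\<^sub>C x"
    and scaleC_of_real: "complex_of_real r *\<^sub>C x = r *\<^sub>R x"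

lemma scaleC_one: "1 *\<^sub>C x = (x :: 'a::complex_vector)"
  using scaleC_of_real[of 1 x] by simp

global_interpretation complex_vector: vector_space "scaleC :: complex \<Rightarrow> 'a \<Rightarrow> 'a :: complex_vector"
  defines cdependent_raw_def: cdependent = complex_vector.dependent
    and crepresentation_raw_def: crepresentation = complex_vector.representation
    and csubspace_raw_def: csubspace = complex_vector.subspace
    and cspan_raw_def: cspan = complex_vector.span
    and cextend_basis_raw_def: cextend_basis = complex_vector.extend_basis
    and cdim_raw_def: cdim = complex_vector.dim
  by unfold_locales (simp_all add: scaleC_add_right scaleC_add_left scaleC_scaleC scaleC_one)

abbreviation cindependent :: "'a::complex_vector set \<Rightarrow> bool"
  where "cindependent B \<equiv> \<not> cdependent B"

class complex_inner = complex_vector + real_normed_vector +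
  fixes cinner :: "'a \<Rightarrow> 'a \<Rightarrow> complex"
  assumes cinner_commute: "cinner x y = cnj (cinner y x)"
    and cinner_add_right: "cinner x (y + z) = cinner x y + cinner x z"
    and cinner_scaleC_right: "cinner x (c *\<^sub>C y) = c * cinner x y"
    and cinner_pos: "x \<noteq> 0 \<Longrightarrow> 0 < Re (cinner x x)"
    and norm_eq_sqrt_cinner: "norm x = sqrt (Re (cinner x x))"

class chilbert_space = complex_inner + complete_space

instantiation complex :: chilbert_space
begin

definition scaleC_complex :: "complex \<Rightarrow> complex \<Rightarrow> complex"
  where "scaleC_complex c z = c * z"

definition cinner_complex :: "complex \<Rightarrow> complex \<Rightarrow> complex"
  where "cinner_complex x y = cnj x * y"

instance
proof
  fix x :: complex
  show "x \<noteq> 0 \<Longrightarrow> 0 < Re (cinner x x)"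
    using complex_neq_0 by (auto simp: cinner_complex_def power2_eq_square)
  show "norm x = sqrt (Re (cinner x x))"
    by (simp add: cinner_complex_def cmod_def power2_eq_square)
qed (simp_all add: scaleC_complex_def cinner_complex_def algebra_simps scaleR_conv_of_real)

end

definition bounded_clinear :: "('a::complex_inner \<Rightarrow> 'b::complex_inner) \<Rightarrow> bool"
  where "bounded_clinear T \<longleftrightarrow> bounded_linear T \<and> (\<forall>c x. T (c *\<^sub>C x) = c *\<^sub>C T x)"

definition clinear_on :: "'a::complex_vector set \<Rightarrow> ('a \<Rightarrow> 'b::complex_vector) \<Rightarrow> bool"
  where "clinear_on S T \<longleftrightarrow>
    (\<forall>x\<in>S. \<forall>y\<in>S. T (x + y) = T x + T y) \<and> (\<forall>c. \<forall>x\<in>S. T (c *\<^sub>C x) = c *\<^sub>C T x)"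


section \<open>Commutative C*-algebras and their representations\<close>

text \<open>The algebra with Gelfand spectrum \<open>\<Lambda>\<close> (a locally compact Hausdorff space, here a type) is
  identified with \<open>C\<^sub>0(\<Lambda>)\<close>, with pointwise operations and the supremum norm.\<close>

definition C0 :: "('l::topological_space \<Rightarrow> complex) set"
  where "C0 = {a. continuous_on UNIV a \<and>
    (\<forall>e>0. \<exists>K. compact K \<and> (\<forall>x. x \<notin> K \<longrightarrow> cmod (a x) < e))}"

definition separable_C0 :: "'l::topological_space itself \<Rightarrow> bool"
  where "separable_C0 _ \<longleftrightarrow> (\<exists>D :: ('l \<Rightarrow> complex) set. countable D \<and> D \<subseteq> C0 \<and>
    (\<forall>a\<in>C0. \<forall>e>0. \<exists>d\<in>D. \<forall>x. cmod (a x - d x) < e))"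

definition representation_C0 :: "(('l::topological_space \<Rightarrow> complex) \<Rightarrow> 'h::chilbert_space \<Rightarrow> 'h) \<Rightarrow> bool"
  where "representation_C0 \<pi> \<longleftrightarrow>
    (\<forall>a\<in>C0. bounded_clinear (\<pi> a)) \<and>
    (\<forall>a\<in>C0. \<forall>b\<in>C0. \<forall>u. \<pi> (\<lambda>x. a x + b x) u = \<pi> a u + \<pi> b u) \<and>
    (\<forall>c. \<forall>a\<in>C0. \<forall>u. \<pi> (\<lambda>x. c * a x) u = c *\<^sub>C \<pi> a u) \<and>
    (\<forall>a\<in>C0. \<forall>b\<in>C0. \<forall>u. \<pi> (\<lambda>x. a x * b x) u = \<pi> a (\<pi> b u)) \<and>
    (\<forall>a\<in>C0. \<forall>u v. cinner u (\<pi> (\<lambda>x. cnj (a x)) v) = cinner (\<pi> a u) v)"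

definition nondegenerate :: "(('l::topological_space \<Rightarrow> complex) \<Rightarrow> 'h::chilbert_space \<Rightarrow> 'h) \<Rightarrow> bool"
  where "nondegenerate \<pi> \<longleftrightarrow> closure (cspan {\<pi> a u | a u. a \<in> C0}) = UNIV"

definition unitary_group :: "(real \<Rightarrow> 'h::chilbert_space \<Rightarrow> 'h) \<Rightarrow> bool"
  where "unitary_group U \<longleftrightarrow>
    (\<forall>t. bounded_clinear (U t) \<and> surj (U t) \<and> (\<forall>u v. cinner (U t u) (U t v) = cinner u v)) \<and>
    U 0 = id \<and> (\<forall>s t. U (s + t) = U s \<circ> U t)"

definition asymptotically_contained_via ::
  "(('l::topological_space \<Rightarrow> complex) \<Rightarrow> 'h0::chilbert_space \<Rightarrow> 'h0) \<Rightarrow>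
   (('l \<Rightarrow> complex) \<Rightarrow> 'h::chilbert_space \<Rightarrow> 'h) \<Rightarrow>
   (real \<Rightarrow> 'h0 \<Rightarrow> 'h0) \<Rightarrow> ('h0 \<Rightarrow> 'h) \<Rightarrow> bool"
  where "asymptotically_contained_via \<pi>0 \<pi> U W \<longleftrightarrow>
    unitary_group U \<and> (\<forall>t. \<forall>a\<in>C0. U t \<circ> \<pi>0 a = \<pi>0 a \<circ> U t) \<and>
    bounded_clinear W \<and>
    (\<forall>a\<in>C0. \<forall>u v.
      ((\<lambda>t. cinner u (\<pi>0 a v) - cinner (W (U t u)) (\<pi> a (W (U t v)))) \<longlongrightarrow> 0) at_top)"


section \<open>Continuous fields of finite-dimensional Hilbert spaces\<close>

text \<open>The fibres are complex subspaces of one ambient complex vector space, which plays no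
  other role: every family of vector spaces embeds in its direct sum, and the inner product
  is given fibre by fibre. Sections are functions on the whole of \<open>'l\<close>, of which only the values
  on the base are relevant.\<close>

record ('l, 'e) hfield =
  fibre :: "'l \<Rightarrow> 'e set"
  fip :: "'l \<Rightarrow> 'e \<Rightarrow> 'e \<Rightarrow> complex"
  sections :: "('l \<Rightarrow> 'e) set"

definition fnorm :: "('l, 'e) hfield \<Rightarrow> 'l \<Rightarrow> 'e \<Rightarrow> real"
  where "fnorm E l v = sqrt (Re (fip E l v v))"

definition findim_hilbert :: "'e::complex_vector set \<Rightarrow> ('e \<Rightarrow> 'e \<Rightarrow> complex) \<Rightarrow> bool"
  where "findim_hilbert S ip \<longleftrightarrow>
    (\<exists>B. finite B \<and> S = cspan B) \<and>
    (\<forall>x\<in>S. \<forall>y\<in>S. ip x y = cnj (ip y x)) \<and>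
    (\<forall>x\<in>S. \<forall>y\<in>S. \<forall>z\<in>S. ip x (y + z) = ip x y + ip x z) \<and>
    (\<forall>x\<in>S. \<forall>y\<in>S. \<forall>c. ip x (c *\<^sub>C y) = c * ip x y) \<and>
    (\<forall>x\<in>S. x \<noteq> 0 \<longrightarrow> 0 < Re (ip x x))"

text \<open>\<open>z\<close> is a continuous section over \<open>S\<close> of the pull-back of \<open>E\<close> along \<open>f\<close>: near each
  point, it is uniformly approximated by continuous sections of \<open>E\<close>. With \<open>f = id\<close>
  this gives the continuous sections of the restriction of \<open>E\<close> to \<open>S\<close>.\<close>

definition continuous_section_along ::
  "('l, 'e::complex_vector) hfield \<Rightarrow> ('s::topological_space \<Rightarrow> 'l) \<Rightarrow> 's set \<Rightarrow> ('s \<Rightarrow> 'e) \<Rightarrow> bool"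
  where "continuous_section_along E f S z \<longleftrightarrow>
    (\<forall>s\<in>S. z s \<in> fibre E (f s)) \<and>
    (\<forall>s\<in>S. \<forall>e>0. \<exists>x\<in>sections E. \<exists>V. open V \<and> s \<in> V \<and>
      (\<forall>r\<in>V \<inter> S. fnorm E (f r) (z r - x (f r)) < e))"

definition continuous_section_on ::
  "('l::topological_space, 'e::complex_vector) hfield \<Rightarrow> 'l set \<Rightarrow> ('l \<Rightarrow> 'e) \<Rightarrow> bool"
  where "continuous_section_on E S z \<longleftrightarrow> continuous_section_along E id S z"

text \<open>Dixmier's axioms for a continuous field of Hilbert spaces (with finite-dimensional
  fibres).\<close>

definition continuous_hfield :: "'l::topological_space set \<Rightarrow> ('l, 'e::complex_vector) hfield \<Rightarrow> bool"
  where "continuous_hfield X E \<longleftrightarrow>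
    (\<forall>l\<in>X. findim_hilbert (fibre E l) (fip E l)) \<and>
    (\<forall>x\<in>sections E. \<forall>l\<in>X. x l \<in> fibre E l) \<and>
    (\<lambda>l. 0) \<in> sections E \<and>
    (\<forall>x\<in>sections E. \<forall>y\<in>sections E. (\<lambda>l. x l + y l) \<in> sections E) \<and>
    (\<forall>c. \<forall>x\<in>sections E. (\<lambda>l. c *\<^sub>C x l) \<in> sections E) \<and>
    (\<forall>l\<in>X. \<forall>v\<in>fibre E l. \<forall>e>0. \<exists>x\<in>sections E. fnorm E l (x l - v) < e) \<and>
    (\<forall>x\<in>sections E. continuous_on X (\<lambda>l. fnorm E l (x l))) \<and>
    (\<forall>z. continuous_section_on E X z \<longrightarrow> z \<in> sections E)"

text \<open>Local triviality: near each point of \<open>X\<close> there is an orthonormal frame, that is, an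
  isometric identification of the fibres with \<open>\<complex>\<^sup>n\<close>, under which the continuous sections correspond
  to the continuous \<open>\<complex>\<^sup>n\<close>-valued functions.\<close>

definition locally_trivial_hfield :: "'l::topological_space set \<Rightarrow> ('l, 'e::complex_vector) hfield \<Rightarrow> bool"
  where "locally_trivial_hfield X E \<longleftrightarrow> continuous_hfield X E \<and>
    (\<forall>l\<in>X. \<exists>V (n::nat) (e :: nat \<Rightarrow> 'l \<Rightarrow> 'e). open V \<and> l \<in> V \<and> V \<subseteq> X \<and>
      (\<forall>m\<in>V. fibre E m = cspan ((\<lambda>i. e i m) ` {..<n}) \<and>
        (\<forall>i<n. \<forall>j<n. fip E m (e i m) (e j m) = (if i = j then 1 else 0))) \<and>
      (\<forall>z. continuous_section_on E V z \<longleftrightarrow>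
        (\<exists>c :: nat \<Rightarrow> 'l \<Rightarrow> complex. (\<forall>i<n. continuous_on V (c i)) \<and>
          (\<forall>m\<in>V. z m = (\<Sum>i<n. c i m *\<^sub>C e i m)))))"

definition fibre_adjoint ::
  "'f set \<Rightarrow> ('f \<Rightarrow> 'f \<Rightarrow> complex) \<Rightarrow> ('e \<Rightarrow> 'e \<Rightarrow> complex) \<Rightarrow> ('f \<Rightarrow> 'e) \<Rightarrow> 'e \<Rightarrow> 'f"
  where "fibre_adjoint S ipS ipT C w = (THE v. v \<in> S \<and> (\<forall>u\<in>S. ipS u v = ipT (C u) w))"

definition ctrace :: "'f::complex_vector set \<Rightarrow> ('f \<Rightarrow> 'f) \<Rightarrow> complex"
  where "ctrace S T =
    (let B = (SOME B. cindependent B \<and> cspan B = S) in \<Sum>b\<in>B. crepresentation B (T b) b)"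


text \<open>The function \<open>Trace(C\<^sub>\<lambda>\<^sup>* C\<^sub>\<lambda>) / dim(H\<^sub>0\<^sub>,\<^sub>\<lambda>)\<close>; the trace is real because \<open>C\<^sub>\<lambda>\<^sup>* C\<^sub>\<lambda>\<close> is positive.\<close>

definition trace_density ::
  "('l, 'f::complex_vector) hfield \<Rightarrow> ('l, 'e::complex_vector) hfield \<Rightarrow> ('l \<Rightarrow> 'f \<Rightarrow> 'e) \<Rightarrow> 'l \<Rightarrow> real"
  where "trace_density E E0 C l =
    Re (ctrace (fibre E l) (fibre_adjoint (fibre E l) (fip E l) (fip E0 l) (C l) \<circ> C l))
      / real (cdim (fibre E0 l))"


section \<open>The standing assumptions\<close>

text \<open>The map \<open>h \<mapsto> {h\<^sub>0\<^sub>,\<^sub>\<lambda>}\<close> is \<open>ev0\<close>, the map \<open>h \<mapsto> {h\<^sub>\<lambda>}\<close> is \<open>ev\<close>; their values outside the given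
  dense subspaces \<open>D0\<close> and \<open>D\<close> are irrelevant.\<close>

definition assumption_A ::
  "(('l::t2_space \<Rightarrow> complex) \<Rightarrow> 'h0::chilbert_space \<Rightarrow> 'h0) \<Rightarrow> 'l set \<Rightarrow>
   ('l, 'e::complex_vector) hfield \<Rightarrow> 'h0 set \<Rightarrow> ('h0 \<Rightarrow> 'l \<Rightarrow> 'e) \<Rightarrow> 'l measure \<Rightarrow> bool"
  where "assumption_A \<pi>0 \<Lambda>0 E0 D0 ev0 \<mu>0 \<longleftrightarrow>
    open \<Lambda>0 \<and> locally_trivial_hfield \<Lambda>0 E0 \<and>
    csubspace D0 \<and> closure D0 = UNIV \<and>
    (\<forall>h\<in>D0. ev0 h \<in> sections E0) \<and>
    (\<forall>l\<in>\<Lambda>0. clinear_on D0 (\<lambda>h. ev0 h l)) \<and>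
    (\<forall>l\<in>\<Lambda>0. fibre E0 l = {ev0 h l | h. h \<in> D0}) \<and>
    sets \<mu>0 = sets (restrict_space borel \<Lambda>0) \<and>
    (\<forall>h\<in>D0. \<forall>g\<in>D0. integrable \<mu>0 (\<lambda>l. fip E0 l (ev0 h l) (ev0 g l)) \<and>
      (\<forall>a\<in>C0. cinner h (\<pi>0 a g) = (\<integral>l. fip E0 l (ev0 h l) (ev0 g l) * a l \<partial>\<mu>0)))"

text \<open>Continuity of the action is joint continuity: for each continuous section \<open>x\<close>, the map
  \<open>(t, \<lambda>) \<mapsto> U\<^sub>t\<^sub>,\<^sub>\<lambda> x\<^sub>\<lambda>\<close> is a continuous section of the pull-back of the field to \<open>\<real> \<times> \<Lambda>\<^sub>0\<close>.\<close>

definition assumption_B ::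
  "(real \<Rightarrow> 'h0::chilbert_space \<Rightarrow> 'h0) \<Rightarrow> 'l::t2_space set \<Rightarrow> ('l, 'e::complex_vector) hfield \<Rightarrow>
   'h0 set \<Rightarrow> ('h0 \<Rightarrow> 'l \<Rightarrow> 'e) \<Rightarrow> (real \<Rightarrow> 'l \<Rightarrow> 'e \<Rightarrow> 'e) \<Rightarrow> bool"
  where "assumption_B U \<Lambda>0 E0 D0 ev0 UF \<longleftrightarrow>
    (\<forall>t. U t ` D0 \<subseteq> D0) \<and>
    (\<forall>l\<in>\<Lambda>0. \<forall>t. clinear_on (fibre E0 l) (UF t l) \<and> UF t l ` fibre E0 l = fibre E0 l \<and>
      (\<forall>v\<in>fibre E0 l. \<forall>w\<in>fibre E0 l. fip E0 l (UF t l v) (UF t l w) = fip E0 l v w)) \<and>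
    (\<forall>l\<in>\<Lambda>0. \<forall>v\<in>fibre E0 l. UF 0 l v = v \<and> (\<forall>s t. UF (s + t) l v = UF s l (UF t l v))) \<and>
    (\<forall>x\<in>sections E0.
      continuous_section_along E0 snd (UNIV \<times> \<Lambda>0) (\<lambda>(t, l). UF t l (x l))) \<and>
    (\<forall>h\<in>D0. \<forall>t. \<forall>l\<in>\<Lambda>0. ev0 (U t h) l = UF t l (ev0 h l))"

definition assumption_C ::
  "(('l::t2_space \<Rightarrow> complex) \<Rightarrow> 'h::chilbert_space \<Rightarrow> 'h) \<Rightarrow>
   (real \<Rightarrow> 'h0::chilbert_space \<Rightarrow> 'h0) \<Rightarrow> ('h0 \<Rightarrow> 'h) \<Rightarrow> 'h0 set \<Rightarrow>
   ('l, 'f::complex_vector) hfield \<Rightarrow> 'h set \<Rightarrow> ('h \<Rightarrow> 'l \<Rightarrow> 'f) \<Rightarrow> 'l measure \<Rightarrow> bool"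
  where "assumption_C \<pi> U W D0 E D ev \<mu> \<longleftrightarrow>
    locally_trivial_hfield UNIV E \<and> (\<forall>l. cdim (fibre E l) = 1) \<and>
    csubspace D \<and> closure D = UNIV \<and>
    (\<forall>h\<in>D0. \<forall>\<^sub>F t in at_top. W (U t h) \<in> D) \<and>
    (\<forall>l. clinear_on D (\<lambda>h. ev h l)) \<and>
    (\<forall>h\<in>D. ev h \<in> sections E) \<and>
    sets \<mu> = sets borel \<and>
    (\<forall>h\<in>D. \<forall>g\<in>D. integrable \<mu> (\<lambda>l. fip E l (ev h l) (ev g l)) \<and>
      (\<forall>a\<in>C0. cinner h (\<pi> a g) = (\<integral>l. fip E l (ev h l) (ev g l) * a l \<partial>\<mu>)))"

text \<open>The family \<open>C\<close> is continuous if it maps continuous sections over \<open>\<Lambda>\<^sub>0\<close> to continuous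
  sections. The supremum is taken in \<open>[0, \<infinity>]\<close>, so that it is \<open>0\<close> for empty \<open>K\<close>.\<close>

definition assumption_D ::
  "(real \<Rightarrow> 'h0 \<Rightarrow> 'h0) \<Rightarrow> ('h0 \<Rightarrow> 'h) \<Rightarrow> 'l::t2_space set \<Rightarrow>
   ('l, 'e::complex_vector) hfield \<Rightarrow> 'h0 set \<Rightarrow> ('h0 \<Rightarrow> 'l \<Rightarrow> 'e) \<Rightarrow>
   ('l, 'f::complex_vector) hfield \<Rightarrow> ('h \<Rightarrow> 'l \<Rightarrow> 'f) \<Rightarrow> ('l \<Rightarrow> 'f \<Rightarrow> 'e) \<Rightarrow> bool"
  where "assumption_D U W \<Lambda>0 E0 D0 ev0 E ev C \<longleftrightarrow>
    (\<forall>l\<in>\<Lambda>0. clinear_on (fibre E l) (C l) \<and> C l ` fibre E l \<subseteq> fibre E0 l \<and> inj_on (C l) (fibre E l)) \<and>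
    (\<forall>v. continuous_section_on E \<Lambda>0 v \<longrightarrow> continuous_section_on E0 \<Lambda>0 (\<lambda>l. C l (v l))) \<and>
    (\<forall>h\<in>D0. \<forall>v\<in>sections E. \<forall>K. compact K \<and> K \<subseteq> \<Lambda>0 \<longrightarrow>
      ((\<lambda>t. SUP l\<in>K. ennreal (cmod
          (fip E0 l (C l (v l)) (ev0 (U t h) l) - fip E l (v l) (ev (W (U t h)) l)))) \<longlongrightarrow> 0) at_top)"

end

theory Submission
  imports Defs
begin

text \<open>The two measures are compared on continuous functions with compact support in a small open
  subset \<open>V\<close> of \<open>\<Lambda>\<^sub>0\<close>. Choose a continuous section \<open>v\<close> of the line bundle without zeros on \<open>V\<close>. Since
  the fibres \<open>H\<^sub>\<lambda>\<close> are lines, \<open>\<langle>k\<^sub>\<lambda>, k'\<^sub>\<lambda>\<rangle> |v\<^sub>\<lambda>|\<^sup>2\<close> is the conjugate of \<open>\<langle>v\<^sub>\<lambda>, k\<^sub>\<lambda>\<rangle>\<close> times \<open>\<langle>v\<^sub>\<lambda>, k'\<^sub>\<lambda>\<rangle>\<close>. For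
  \<open>k = W U\<^sub>t h\<close> and \<open>k' = W U\<^sub>t g\<close> these pairings approach \<open>\<langle>C\<^sub>\<lambda> v\<^sub>\<lambda>, (U\<^sub>t h)\<^sub>\<lambda>\<rangle>\<close> and \<open>\<langle>C\<^sub>\<lambda> v\<^sub>\<lambda>, (U\<^sub>t g)\<^sub>\<lambda>\<rangle>\<close>
  uniformly on compact sets. Asymptotic containment therefore yields, for every test function \<open>b\<close>,
  that the integral of
  the conjugate of \<open>\<langle>C v, U\<^sub>t h\<rangle>\<close> times \<open>\<langle>C v, U\<^sub>t g\<rangle> b\<close> with respect to \<open>\<mu>\<close> tends to the integral of
  \<open>\<langle>h, g\<rangle> |v|\<^sup>2 b\<close> with respect to \<open>\<mu>\<^sub>0\<close> (lemma \<open>pairing_limit_ev0\<close>).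

  Both sides are sesquilinear over continuous functions in \<open>h\<close> and \<open>g\<close>, so the limit holds for all local
  combinations of the given sections with continuous coefficients (\<open>pairing_limit\<close>). Among these there
  is an orthonormal frame \<open>u\<^sub>1, \<dots>, u\<^sub>n\<close> of the bundle over \<open>V\<close> (\<open>local_Gram_Schmidt\<close>). Put \<open>h = g = u\<^sub>i\<close> and
  sum over \<open>i\<close>. The flow is unitary in each fibre, so \<open>U\<^sub>t u\<^sub>1, \<dots>, U\<^sub>t u\<^sub>n\<close> is again an orthonormal basis,
  and by Parseval the sum of the \<open>|\<langle>C v, U\<^sub>t u\<^sub>i\<rangle>|\<^sup>2\<close> is \<open>|C v|\<^sup>2\<close>, whatever \<open>t\<close> is. The limit becomes an identity:
  \<open>\<integral> |C v|\<^sup>2 b d\<mu> = n \<integral> |v|\<^sup>2 b d\<mu>\<^sub>0\<close>. On a line \<open>|C v|\<^sup>2 / |v|\<^sup>2\<close> is the trace of \<open>C\<^sup>* C\<close>, and replacing \<open>b\<close> by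
  \<open>b / (n |v|\<^sup>2)\<close> gives the asserted density on \<open>V\<close> (\<open>local_trace_formula\<close>).

  Two points of measure theory remain. The estimate requires that \<open>\<mu>\<close> be finite near each point
  of \<open>\<Lambda>\<^sub>0\<close>; this follows from the integrability of \<open>|k\<^sub>\<lambda>|\<^sup>2\<close> once some \<open>k\<close> does not vanish at the point, and
  Parseval provides such a \<open>k\<close> of the form \<open>W U\<^sub>t h\<close> with \<open>t\<close> large (\<open>ev_nonzero\<close>). And the local identities
  determine the measures on \<open>\<Lambda>\<^sub>0\<close> because separability of the algebra gives the spectrum a countable
  base of sets of the form \<open>{f > 0}\<close> with \<open>f\<close> a test function (\<open>measure_eqI_test_functions\<close>).\<close>

section \<open>Finite-dimensional inner product spaces\<close>

locale hilbert_fibre =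
  fixes S :: "'e::complex_vector set" and ip :: "'e \<Rightarrow> 'e \<Rightarrow> complex"
  assumes findim_hilbert: "findim_hilbert S ip"
begin

lemma subspace: "csubspace S"
proof -
  obtain F where "S = cspan F" using findim_hilbert[unfolded findim_hilbert_def, THEN conjunct1] by blast
  then show ?thesis using complex_vector.subspace_span by simp
qed

lemmas zero_mem = complex_vector.subspace_0[OF subspace]
  and add_mem = complex_vector.subspace_add[OF subspace]
  and scale_mem = complex_vector.subspace_scale[OF subspace]
  and diff_mem = complex_vector.subspace_diff[OF subspace]
  and sum_mem = complex_vector.subspace_sum[OF subspace]

lemma ip_commute: "x \<in> S \<Longrightarrow> y \<in> S \<Longrightarrow> ip x y = cnj (ip y x)"
  by (rule findim_hilbert[unfolded findim_hilbert_def, THEN conjunct2, THEN conjunct1, rule_format])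

lemma ip_add_right: "x \<in> S \<Longrightarrow> y \<in> S \<Longrightarrow> z \<in> S \<Longrightarrow> ip x (y + z) = ip x y + ip x z"
  by (rule findim_hilbert[unfolded findim_hilbert_def, THEN conjunct2, THEN conjunct2,
        THEN conjunct1, rule_format])

lemma ip_scale_right: "x \<in> S \<Longrightarrow> y \<in> S \<Longrightarrow> ip x (c *\<^sub>C y) = c * ip x y"
  by (rule findim_hilbert[unfolded findim_hilbert_def, THEN conjunct2, THEN conjunct2,
        THEN conjunct2, THEN conjunct1, rule_format])

lemma ip_pos: "x \<in> S \<Longrightarrow> x \<noteq> 0 \<Longrightarrow> 0 < Re (ip x x)"
  by (rule findim_hilbert[unfolded findim_hilbert_def, THEN conjunct2, THEN conjunct2,
        THEN conjunct2, THEN conjunct2, rule_format])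

lemma ip_diff_right: "x \<in> S \<Longrightarrow> y \<in> S \<Longrightarrow> z \<in> S \<Longrightarrow> ip x (y - z) = ip x y - ip x z"
  using ip_add_right[of x "y - z" z] by (simp add: diff_mem)

lemma ip_add_left: "x \<in> S \<Longrightarrow> y \<in> S \<Longrightarrow> z \<in> S \<Longrightarrow> ip (x + y) z = ip x z + ip y z"
proof -
  assume x: "x \<in> S" and y: "y \<in> S" and z: "z \<in> S"
  have "ip (x + y) z = cnj (ip z (x + y))" by (rule ip_commute[OF add_mem[OF x y] z])
  also have "\<dots> = cnj (ip z x) + cnj (ip z y)" using x y z by (simp add: ip_add_right)
  also have "\<dots> = ip x z + ip y z" by (simp only: ip_commute[OF x z] ip_commute[OF y z])
  finally show ?thesis .
qed

lemma ip_scale_left: "x \<in> S \<Longrightarrow> y \<in> S \<Longrightarrow> ip (c *\<^sub>C x) y = cnj c * ip x y"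
proof -
  assume x: "x \<in> S" and y: "y \<in> S"
  have "ip (c *\<^sub>C x) y = cnj (ip y (c *\<^sub>C x))" by (rule ip_commute[OF scale_mem[OF x] y])
  also have "\<dots> = cnj c * cnj (ip y x)" using x y by (simp add: ip_scale_right)
  also have "\<dots> = cnj c * ip x y" by (simp only: ip_commute[OF x y])
  finally show ?thesis .
qed

lemma ip_zero_right: "x \<in> S \<Longrightarrow> ip x 0 = 0"
  using ip_scale_right[of x 0 0] zero_mem by simp

lemma ip_zero_left: "x \<in> S \<Longrightarrow> ip 0 x = 0"
  using ip_scale_left[of 0 x 0] zero_mem by simp

lemma ip_sum_right:
  assumes "finite I" "x \<in> S" "\<And>i. i \<in> I \<Longrightarrow> f i \<in> S"
  shows "ip x (sum f I) = (\<Sum>i\<in>I. ip x (f i))"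
  using assms by (induction I rule: finite_induct) (auto simp: ip_zero_right ip_add_right sum_mem)

lemma ip_self: "x \<in> S \<Longrightarrow> ip x x = complex_of_real (Re (ip x x))"
proof -
  assume "x \<in> S"
  then have "cnj (ip x x) = ip x x" using ip_commute[of x x, symmetric] by blast
  then show ?thesis by (metis Reals_cnj_iff of_real_Re)
qed

lemma ip_self_nonneg: "x \<in> S \<Longrightarrow> 0 \<le> Re (ip x x)"
  using ip_pos[of x] ip_zero_right[of x] by (cases "x = 0") auto

lemma Cauchy_Schwarz:
  assumes x: "x \<in> S" and y: "y \<in> S"
  shows "(cmod (ip x y))\<^sup>2 \<le> Re (ip x x) * Re (ip y y)"
proof (cases "x = 0")
  case True
  then show ?thesis using y zero_mem by (simp add: ip_zero_left)
next
  case False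
  define p where "p = Re (ip x x)"
  have p: "0 < p" "ip x x = of_real p"
    using ip_pos[OF x False] ip_self[OF x] by (auto simp: p_def)
  define k where "k = ip x y"
  \<comment> \<open>\<open>r\<close> is the component of \<open>y\<close> orthogonal to \<open>x\<close>\<close>
  define r where "r = y - (k / p) *\<^sub>C x"
  have mem: "(k / p) *\<^sub>C x \<in> S" "r \<in> S"
    using x y by (auto simp: r_def intro!: diff_mem scale_mem)
  have "ip x r = 0"
    unfolding r_def using p mem x y by (simp add: ip_diff_right ip_scale_right k_def)
  moreover have "ip y r = ip r r + ip ((k / p) *\<^sub>C x) r"
    using ip_add_left[OF mem(2,1,2)] by (simp add: r_def)
  ultimately have "ip r r = ip y r"
    using mem x by (simp add: ip_scale_left)
  also have "\<dots> = ip y y - (k / p) * ip y x"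
    unfolding r_def using x y mem by (simp add: ip_diff_right ip_scale_right)
  also have "ip y x = cnj k" using ip_commute[OF y x] by (simp add: k_def)
  also have "ip y y - (k / p) * cnj k = of_real (Re (ip y y) - (cmod k)\<^sup>2 / p)"
    by (subst ip_self[OF y]) (simp add: complex_norm_square[symmetric])
  finally have "0 \<le> Re (ip y y) - (cmod k)\<^sup>2 / p" using ip_self_nonneg[OF mem(2)] by simp
  then show ?thesis using p by (simp add: k_def p_def[symmetric] field_simps)
qed

definition orthonormal :: "nat \<Rightarrow> (nat \<Rightarrow> 'e) \<Rightarrow> bool"
  where "orthonormal n u \<longleftrightarrow> (\<forall>i<n. u i \<in> S) \<and>
    (\<forall>i<n. \<forall>j<n. ip (u i) (u j) = (if i = j then 1 else 0))"

lemma orthonormal_coefficient: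
  assumes "orthonormal n u" "i < n"
  shows "ip (u i) (\<Sum>j<n. c j *\<^sub>C u j) = c i"
proof -
  have "ip (u i) (\<Sum>j<n. c j *\<^sub>C u j) = (\<Sum>j<n. ip (u i) (c j *\<^sub>C u j))"
    using assms by (intro ip_sum_right) (auto simp: orthonormal_def scale_mem)
  also have "\<dots> = (\<Sum>j<n. if i = j then c j else 0)"
    using assms by (intro sum.cong) (auto simp: orthonormal_def ip_scale_right)
  finally show ?thesis using assms(2) by simp
qed

lemma orthonormal_inj: "orthonormal n u \<Longrightarrow> inj_on u {..<n}"
proof (rule inj_onI, rule ccontr)
  fix i j assume on: "orthonormal n u" and ij: "i \<in> {..<n}" "j \<in> {..<n}" "i \<noteq> j"
    and eq: "u i = u j"
  have "ip (u i) (u j) = 0" "ip (u i) (u i) = 1" using on ij by (simp_all add: orthonormal_def)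
  then show False using eq by simp
qed

lemma orthonormal_independent:
  assumes "orthonormal n u"
  shows "cindependent (u ` {..<n})"
proof (rule complex_vector.independent_if_scalars_zero)
  fix f x assume s: "(\<Sum>x\<in>u ` {..<n}. f x *\<^sub>C x) = 0" and "x \<in> u ` {..<n}"
  then obtain i where i: "i < n" "x = u i" by auto
  have "(\<Sum>j<n. f (u j) *\<^sub>C u j) = 0"
    using s by (simp add: sum.reindex[OF orthonormal_inj[OF assms]] o_def)
  then have "f (u i) = ip (u i) 0"
    using orthonormal_coefficient[OF assms i(1), of "\<lambda>j. f (u j)"] by simp
  then show "f x = 0" using i assms by (simp add: ip_zero_right orthonormal_def)
qed auto

lemma orthonormal_le_cdim:
  assumes "orthonormal n u"
  shows "n \<le> cdim S"
proof -
  obtain F where F: "finite F" "S = cspan F"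
    using findim_hilbert[unfolded findim_hilbert_def, THEN conjunct1] by blast
  obtain B where B: "B \<subseteq> S" "cindependent B" "S \<subseteq> cspan B" "card B = cdim S"
    using complex_vector.basis_exists by blast
  have "finite B" using complex_vector.independent_span_bound[OF F(1) B(2)] B(1) F(2) by auto
  moreover have "u ` {..<n} \<subseteq> cspan B" using assms B(3) by (auto simp: orthonormal_def)
  ultimately have "card (u ` {..<n}) \<le> card B"
    using complex_vector.independent_span_bound[OF _ orthonormal_independent[OF assms]] by blast
  then show ?thesis using B(4) card_image[OF orthonormal_inj[OF assms]] by simp
qed

text \<open>The next two lemmas are one step of the Gram-Schmidt process. The coefficients are written as
  explicit functions of the inner products, so that they depend continuously on the base point when
  the step is carried out in all fibres of a field at once.\<close>

lemma orthonormal_residual: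
  assumes on: "orthonormal n u" and w: "w \<in> S" and i: "i < n"
  shows "ip (u i) (w + (\<Sum>j<n. (- ip (u j) w) *\<^sub>C u j)) = 0"
proof -
  have u: "\<And>i. i < n \<Longrightarrow> u i \<in> S" using on by (auto simp: orthonormal_def)
  have "(\<Sum>j<n. (- ip (u j) w) *\<^sub>C u j) \<in> S" by (intro sum_mem scale_mem u) auto
  then show ?thesis
    using orthonormal_coefficient[OF on i, of "\<lambda>j. - ip (u j) w"] u[OF i] w
    by (simp add: ip_add_right)
qed

lemma orthonormal_extend:
  assumes on: "orthonormal n u" and r: "r \<in> S" "0 < Re (ip r r)"
    and orth: "\<And>i. i < n \<Longrightarrow> ip (u i) r = 0"
  shows "orthonormal (Suc n) (u(n := complex_of_real (1 / sqrt (Re (ip r r))) *\<^sub>C r))"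
proof -
  define q where "q = Re (ip r r)"
  have q: "0 < q" "ip r r = of_real q" using r(2) ip_self[OF r(1)] by (auto simp: q_def)
  define u' where "u' = u(n := complex_of_real (1 / sqrt q) *\<^sub>C r)"
  have u: "\<And>i. i < n \<Longrightarrow> u i \<in> S" using on by (auto simp: orthonormal_def)
  have "complex_of_real (sqrt q) * complex_of_real (sqrt q) = of_real q"
    using q(1) by (metis of_real_mult real_sqrt_mult_self abs_of_pos)
  then have "ip (u' n) (u' n) = 1"
    unfolding u'_def using r q by (simp add: ip_scale_left ip_scale_right scale_mem)
  moreover have "ip (u' i) (u' n) = 0" "ip (u' n) (u' i) = 0" if "i < n" for i
    using that u r orth ip_commute[OF r(1) u[OF that]]
    by (auto simp: u'_def ip_scale_left ip_scale_right)
  ultimately have "orthonormal (Suc n) u'"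
    using on r unfolding orthonormal_def by (auto simp: less_Suc_eq u'_def scale_mem)
  then show ?thesis by (simp add: u'_def q_def)
qed

text \<open>If the expansion of \<open>w\<close> left a remainder, the normalized remainder would extend the
  family to one with more members than the dimension allows.\<close>

lemma orthonormal_expansion:
  assumes on: "orthonormal n u" and n: "n = cdim S" and w: "w \<in> S"
  shows "w = (\<Sum>i<n. ip (u i) w *\<^sub>C u i)"
proof (rule ccontr)
  assume ne: "w \<noteq> (\<Sum>i<n. ip (u i) w *\<^sub>C u i)"
  define r where "r = w + (\<Sum>i<n. (- ip (u i) w) *\<^sub>C u i)"
  have "(\<Sum>i<n. (- ip (u i) w) *\<^sub>C u i) \<in> S"
    using on by (intro sum_mem scale_mem) (auto simp: orthonormal_def)
  then have r: "r \<in> S" unfolding r_def by (intro add_mem w)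
  have "r \<noteq> 0" using ne by (simp add: r_def sum_negf)
  then have "0 < Re (ip r r)" by (rule ip_pos[OF r])
  from orthonormal_extend[OF on r this] orthonormal_residual[OF on w, folded r_def]
  have "Suc n \<le> cdim S" by (intro orthonormal_le_cdim) blast
  then show False using n by simp
qed

lemma Parseval:
  assumes on: "orthonormal n u" and n: "n = cdim S" and w: "w \<in> S"
  shows "(\<Sum>i<n. cnj (ip w (u i)) * ip w (u i)) = ip w w"
proof -
  have u: "\<And>i. i < n \<Longrightarrow> u i \<in> S" using on by (auto simp: orthonormal_def)
  have "ip w w = ip w (\<Sum>i<n. ip (u i) w *\<^sub>C u i)"
    using orthonormal_expansion[OF assms] by simp
  also have "\<dots> = (\<Sum>i<n. ip w (ip (u i) w *\<^sub>C u i))"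
    using u w by (intro ip_sum_right) (auto intro: scale_mem)
  also have "\<dots> = (\<Sum>i<n. cnj (ip w (u i)) * ip w (u i))"
    using u w by (intro sum.cong) (auto simp: ip_scale_right ip_commute[OF u w])
  finally show ?thesis by simp
qed

lemma orthonormal_spanning_cdim:
  assumes "orthonormal n u" "S = cspan (u ` {..<n})"
  shows "cdim S = n"
proof -
  have "cspan (u ` {..<n}) = cspan S" by (subst assms(2)) (simp only: complex_vector.span_span)
  from complex_vector.dim_eq_card[OF this orthonormal_independent[OF assms(1)]]
  show ?thesis using card_image[OF orthonormal_inj[OF assms(1)]] by simp
qed

lemma line_generator:
  assumes "cdim S = 1"
  obtains u where "u \<in> S" "u \<noteq> 0" "\<And>x. x \<in> S \<Longrightarrow> \<exists>k. x = k *\<^sub>C u"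
proof -
  obtain B where B: "B \<subseteq> S" "cindependent B" "S \<subseteq> cspan B" "card B = cdim S"
    using complex_vector.basis_exists by blast
  then obtain u where u: "B = {u}" using assms card_1_singletonE by metis
  show ?thesis
  proof (rule that)
    show "u \<in> S" "u \<noteq> 0" using B u by (auto simp: complex_vector.dependent_single)
    show "\<exists>k. x = k *\<^sub>C u" if "x \<in> S" for x
      using that B(3) u by (auto simp: complex_vector.span_singleton)
  qed
qed

text \<open>In a line bundle this expresses the inner product of two sections through their pairings with
  one nonvanishing section, the only data of the line bundle that are compared with the flow.\<close>

lemma line_ip_product:
  assumes dim: "cdim S = 1" and "v \<in> S" "x \<in> S" "y \<in> S"
  shows "cnj (ip v x) * ip v y = ip v v * ip x y"
proof -
  obtain u where u: "u \<in> S" "u \<noteq> 0" "\<And>x. x \<in> S \<Longrightarrow> \<exists>k. x = k *\<^sub>C u"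
    using line_generator[OF dim] by blast
  obtain p q r where pqr: "v = p *\<^sub>C u" "x = q *\<^sub>C u" "y = r *\<^sub>C u"
    using u(3) assms by metis
  have "cnj (ip u u) = ip u u" by (rule ip_commute[OF u(1) u(1), symmetric])
  then show ?thesis using u(1)
    by (simp add: pqr ip_scale_left ip_scale_right scale_mem)
qed

end

text \<open>On a line the trace of \<open>C\<^sup>* C\<close> is the factor by which \<open>C\<close> scales squared norms, so any
  nonzero vector \<open>v\<close> computes it.\<close>

lemma ctrace_fibre_adjoint_line:
  assumes S: "hilbert_fibre S ipS" and T: "hilbert_fibre T ipT"
    and dim: "cdim S = 1" and lin: "clinear_on S C" and C: "C ` S \<subseteq> T"
    and v: "v \<in> S" "v \<noteq> 0"
  shows "ctrace S (fibre_adjoint S ipS ipT C \<circ> C) = ipT (C v) (C v) / ipS v v"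
proof -
  interpret S: hilbert_fibre S ipS by fact
  interpret T: hilbert_fibre T ipT by fact
  define B where "B = (SOME B. cindependent B \<and> cspan B = S)"
  have "\<exists>B. cindependent B \<and> cspan B = S"
  proof -
    obtain B where B: "B \<subseteq> S" "cindependent B" "S \<subseteq> cspan B"
      by (rule complex_vector.basis_exists)
    have "cspan B \<subseteq> S" by (rule complex_vector.span_minimal[OF B(1) S.subspace])
    then have "cspan B = S" using B(3) by (rule subset_antisym)
    with B(2) show ?thesis by (intro exI conjI)
  qed
  then have B': "cindependent B \<and> cspan B = S" unfolding B_def by (rule someI_ex)
  note B = B'[THEN conjunct1] B'[THEN conjunct2]
  have "cspan B = cspan S" by (simp only: B(2)[symmetric] complex_vector.span_span)
  then have "cdim S = card B" by (rule complex_vector.dim_eq_card[OF _ B(1)])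
  then have "card B = 1" using dim by (rule trans[OF sym])
  then obtain b where b: "B = {b}" by (rule card_1_singletonE)
  have "b \<in> cspan B" unfolding b by (rule complex_vector.span_base) simp
  then have bS: "b \<in> S" by (simp only: B(2))
  have b0: "b \<noteq> 0" using B(1) complex_vector.dependent_zero[of B] unfolding b by fast
  have multiple: "\<exists>k. x = k *\<^sub>C b" if "x \<in> S" for x
  proof -
    have "x \<in> cspan {b}" using that by (simp only: B(2)[symmetric] b)
    then show ?thesis unfolding complex_vector.span_singleton by blast
  qed
  have scaleC: "C (k *\<^sub>C b) = k *\<^sub>C C b" for k
    using lin[unfolded clinear_on_def, THEN conjunct2] bS by blast
  have CbT: "C b \<in> T" using C bS by blast
  have bb: "ipS b b \<noteq> 0" using S.ip_pos[OF bS b0] by (metis less_irrefl zero_complex.sel(1))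
  define k where "k = ipT (C b) (C b) / ipS b b"
  have "fibre_adjoint S ipS ipT C (C b) = k *\<^sub>C b"
    unfolding fibre_adjoint_def
  proof (rule the_equality)
    show "k *\<^sub>C b \<in> S \<and> (\<forall>u\<in>S. ipS u (k *\<^sub>C b) = ipT (C u) (C b))"
    proof (intro conjI ballI)
      show "k *\<^sub>C b \<in> S" using bS by (rule S.scale_mem)
      fix u assume u: "u \<in> S"
      then obtain c where "u = c *\<^sub>C b" using multiple by blast
      then show "ipS u (k *\<^sub>C b) = ipT (C u) (C b)"
        using bS CbT bb by (simp add: scaleC S.ip_scale_left S.ip_scale_right S.scale_mem
            T.ip_scale_left k_def)
    qed
    fix x assume x: "x \<in> S \<and> (\<forall>u\<in>S. ipS u x = ipT (C u) (C b))"
    then obtain c where c: "x = c *\<^sub>C b" using multiple by blast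
    then have "c * ipS b b = ipT (C b) (C b)" using x bS by (auto simp: S.ip_scale_right)
    then show "x = k *\<^sub>C b" using bb c by (simp add: k_def field_simps)
  qed
  moreover have "crepresentation B (k *\<^sub>C b) b = k"
    using B b bS complex_vector.representation_scale[of B b k]
      complex_vector.representation_basis[of B b]
    by (simp add: complex_vector.span_base)
  ultimately have "ctrace S (fibre_adjoint S ipS ipT C \<circ> C) = k"
    unfolding ctrace_def B_def[symmetric] Let_def b by (simp add: b)
  moreover obtain c where c: "v = c *\<^sub>C b" using multiple v by blast
  moreover have "c \<noteq> 0" using c v by auto
  ultimately show ?thesis using bS CbT bb
    by (simp add: scaleC S.ip_scale_left S.ip_scale_right S.scale_mem T.ip_scale_left
        T.ip_scale_right T.scale_mem k_def field_simps)
qed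

section \<open>Test functions\<close>

definition test_function :: "'l::topological_space set \<Rightarrow> ('l \<Rightarrow> 'b::{zero,topological_space}) \<Rightarrow> bool"
  where "test_function V b \<longleftrightarrow> continuous_on UNIV b \<and>
    (\<exists>K. compact K \<and> K \<subseteq> V \<and> (\<forall>x. x \<notin> K \<longrightarrow> b x = 0))"

lemma test_function_mono: "test_function V b \<Longrightarrow> V \<subseteq> V' \<Longrightarrow> test_function V' b"
  unfolding test_function_def by blast

lemma test_function_outside: "test_function V b \<Longrightarrow> x \<notin> V \<Longrightarrow> b x = 0"
  unfolding test_function_def by blast

lemma test_function_continuous: "test_function V b \<Longrightarrow> continuous_on S b"
  unfolding test_function_def using continuous_on_subset by blast

lemma test_function_C0: "test_function V b \<Longrightarrow> b \<in> C0"
proof -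
  assume "test_function V b"
  then obtain K where K: "continuous_on UNIV b" "compact K" "\<And>x. x \<notin> K \<Longrightarrow> b x = 0"
    unfolding test_function_def by blast
  then have "\<forall>e>0. \<exists>K. compact K \<and> (\<forall>x. x \<notin> K \<longrightarrow> cmod (b x) < e)"
    by (intro allI impI exI[of _ K]) simp
  with K(1) show ?thesis unfolding C0_def by blast
qed

text \<open>The factor \<open>f\<close> is arbitrary outside \<open>V\<close>: the product vanishes on the open complement of the
  support of \<open>b\<close>, which together with \<open>V\<close> covers the space.\<close>

lemma test_function_times:
  fixes f b :: "'l::t2_space \<Rightarrow> 'b::real_normed_algebra_1"
  assumes V: "open V" and f: "continuous_on V f" and b: "test_function V b"
  shows "test_function V (\<lambda>x. f x * b x)"
proof -
  obtain K where K: "compact K" "K \<subseteq> V" "\<And>x. x \<notin> K \<Longrightarrow> b x = 0"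
    using b unfolding test_function_def by blast
  have "continuous_on V (\<lambda>x. f x * b x)"
    using f test_function_continuous[OF b] by (intro continuous_intros)
  moreover have "continuous_on (- K) (\<lambda>x. f x * b x)"
    by (rule continuous_on_eq[of _ "\<lambda>x. 0"]) (use K in auto)
  ultimately have "continuous_on (V \<union> - K) (\<lambda>x. f x * b x)"
    using V K(1) by (intro continuous_on_open_Un) (auto simp: compact_imp_closed open_Compl)
  moreover have "V \<union> - K = UNIV" using K by auto
  ultimately show ?thesis unfolding test_function_def using K by auto
qed

lemma test_function_of_real:
  assumes "test_function V b"
  shows "test_function V (\<lambda>x. of_real (b x) :: 'b::real_normed_algebra_1)"
  using assms unfolding test_function_def by (auto intro!: continuous_on_of_real)

lemma open_sets_restrict_space_borel:
  assumes "open X" "sets M = sets (restrict_space borel X)" "open V" "V \<subseteq> X"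
  shows "V \<in> sets M"
  using assms by (auto simp: sets_restrict_space_iff)

lemma test_function_integrable:
  fixes b :: "'l::t2_space \<Rightarrow> 'b::{banach,second_countable_topology}"
  assumes X: "open X" "sets M = sets (restrict_space borel X)" and V: "open V" "V \<subseteq> X"
    and fin: "emeasure M V < \<infinity>" and b: "test_function V b"
  shows "integrable M b"
proof -
  obtain K where K: "compact K" "K \<subseteq> V" "\<And>x. x \<notin> K \<Longrightarrow> b x = 0"
    using b unfolding test_function_def by blast
  have "compact (b ` K)" using K(1) test_function_continuous[OF b] by (rule compact_continuous_image[rotated])
  then obtain B where B: "\<And>x. x \<in> K \<Longrightarrow> norm (b x) \<le> B"
    using compact_imp_bounded bounded_iff by (metis image_eqI)
  have "norm (b x) \<le> max B 0" for x
    by (cases "x \<in> K") (use B[of x] K(3)[of x] in auto)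
  moreover have "b \<in> borel_measurable M"
    using borel_measurable_continuous_onI[OF test_function_continuous[OF b]]
    by (simp add: measurable_cong_sets[OF X(2) refl] measurable_restrict_space1)
  moreover have "b x = 0" if "x \<notin> V" for x using K that by blast
  ultimately show ?thesis
    using fin open_sets_restrict_space_borel[OF X V]
    by (intro integrableI_bounded_set[where A=V and B="max B 0"]) auto
qed

lemma exists_bump_function:
  fixes x :: "'l::t2_space"
  assumes lc: "locally_compact_space (euclidean :: 'l topology)" and V: "open V" "x \<in> V"
  obtains f :: "'l \<Rightarrow> real"
  where "test_function V f" "f x = 1" "\<And>y. 0 \<le> f y" "\<And>y. f y \<le> 1"
proof -
  have H: "Hausdorff_space (euclidean :: 'l topology)"
    unfolding Hausdorff_space_def by (metis disjnt_def hausdorff open_openin)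
  have "neighbourhood_base_of (compactin euclidean) (euclidean :: 'l topology)"
    using lc H locally_compact_space_neighbourhood_base by blast
  then obtain O' K where K: "open O'" "compact K" "x \<in> O'" "O' \<subseteq> K" "K \<subseteq> V"
    using V unfolding neighbourhood_base_of by (auto simp: openin_open) metis
  have "completely_regular_space (euclidean :: 'l topology)"
    using lc H locally_compact_regular_imp_completely_regular_space by blast
  then obtain g where g: "continuous_map euclidean (top_of_set {0..1::real}) g" "g x = 0" "g ` (- O') \<subseteq> {1}"
    unfolding completely_regular_space_def using K(1,3)
    by (metis Diff_iff UNIV_I closed_Compl closed_closedin Compl_iff topspace_euclidean)
  have c: "continuous_on UNIV g" "\<And>y. g y \<in> {0..1}"
    using g(1) by (auto simp: continuous_map_in_subtopology)
  show ?thesis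
  proof (rule that[of "\<lambda>y. 1 - g y"])
    show "test_function V (\<lambda>y. 1 - g y)"
      unfolding test_function_def using K g(3) c by (intro conjI exI[of _ K] continuous_intros) auto
  qed (use c(2) g(2) in auto)
qed

text \<open>A function from a countable dense subset of \<open>C0\<close> that is within \<open>1/4\<close> of a bump exceeds
  \<open>1/2\<close> at the peak, and it is at least \<open>1/2\<close> only where the bump is nonzero. That set is compact,
  because the dense function vanishes at infinity. Truncating the dense functions at \<open>1/2\<close> therefore yields countably many test functions whose
  sets of positivity form a base of the topology.\<close>

lemma countable_test_function_base:
  assumes lc: "locally_compact_space (euclidean :: 'l::t2_space topology)"
    and sep: "separable_C0 TYPE('l::t2_space)"
  obtains F :: "('l::t2_space \<Rightarrow> real) set"
  where "countable F" "\<And>f x. f \<in> F \<Longrightarrow> 0 \<le> f x" "\<And>f x. f \<in> F \<Longrightarrow> f x \<le> 1"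
    "\<And>V x. open V \<Longrightarrow> x \<in> V \<Longrightarrow> \<exists>f\<in>F. test_function V f \<and> 0 < f x"
proof -
  obtain D :: "('l \<Rightarrow> complex) set" where D: "countable D" "D \<subseteq> C0"
    "\<And>a e. a \<in> C0 \<Longrightarrow> e > 0 \<Longrightarrow> \<exists>d\<in>D. \<forall>x. cmod (a x - d x) < e"
    using sep unfolding separable_C0_def by metis
  define T where "T = (\<lambda>(d :: 'l \<Rightarrow> complex) x. min 1 (max 0 (cmod (d x) - 1/2)))"
  show ?thesis
  proof (rule that[of "T ` D"])
    fix V :: "'l set" and x assume V: "open V" "x \<in> V"
    obtain f :: "'l \<Rightarrow> real" where f: "test_function V f" "f x = 1"
      using exists_bump_function[OF lc V] by metis
    define a where "a = (\<lambda>y. complex_of_real (f y))"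
    have "a \<in> C0" unfolding a_def using test_function_of_real[OF f(1)] by (rule test_function_C0)
    then obtain d where d: "d \<in> D" "\<And>y. cmod (a y - d y) < 1/4"
      using D(3)[of a "1/4"] by auto
    define K where "K = {y. 1/2 \<le> cmod (d y)}"
    have dc: "continuous_on UNIV d" using d D(2) by (auto simp: C0_def)
    have "closed K" unfolding K_def using dc by (intro closed_Collect_le continuous_intros)
    obtain K' where K': "compact K'" "\<And>y. y \<notin> K' \<Longrightarrow> cmod (d y) < 1/2"
    proof -
      have "d \<in> C0" using d(1) D(2) by blast
      then have "\<forall>e>0. \<exists>K'. compact K' \<and> (\<forall>y. y \<notin> K' \<longrightarrow> cmod (d y) < e)"
        unfolding C0_def by blast
      from this[rule_format, of "1/2"]
      have "\<exists>K'. compact K' \<and> (\<forall>y. y \<notin> K' \<longrightarrow> cmod (d y) < 1/2)" by simp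
      then show ?thesis using that by blast
    qed
    then have "K = K \<inter> K'" unfolding K_def by force
    then have "compact K" using \<open>closed K\<close> K'(1) closed_Int_compact by metis
    moreover have "K \<subseteq> V"
    proof
      fix y assume y: "y \<in> K"
      have "cmod (d y) \<le> cmod (a y) + cmod (a y - d y)"
        by (metis norm_minus_commute norm_triangle_sub)
      then have "a y \<noteq> 0" using y d(2)[of y] by (auto simp: K_def)
      then show "y \<in> V" using test_function_outside[OF f(1), of y] by (auto simp: a_def)
    qed
    moreover have "continuous_on UNIV (T d)" unfolding T_def using dc by (intro continuous_intros)
    moreover have "T d y = 0" if "y \<notin> K" for y using that by (auto simp: T_def K_def)
    ultimately have "test_function V (T d)" unfolding test_function_def by blast
    moreover have "0 < T d x"
    proof -
      have "cmod (a x) \<le> cmod (d x) + cmod (a x - d x)" by (rule norm_triangle_sub)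
      then have "cmod (d x) > 1/2" using d(2)[of x] f(2) by (simp add: a_def)
      then show ?thesis by (simp add: T_def)
    qed
    ultimately show "\<exists>f\<in>T ` D. test_function V f \<and> 0 < f x" using d(1) by blast
  qed (use D(1) in \<open>auto simp: T_def\<close>)
qed

section \<open>Measures determined by test functions\<close>

text \<open>The countable base of sets of positivity supplies a countable cover by sets of finite
  measure.\<close>

lemma sigma_finite_of_locally_finite:
  assumes lc: "locally_compact_space (euclidean :: 'l::t2_space topology)"
    and sep: "separable_C0 TYPE('l::t2_space)"
    and X: "open X" "sets M = sets (restrict_space borel X)"
    and local: "\<And>x. x \<in> X \<Longrightarrow> \<exists>V. open V \<and> x \<in> V \<and> V \<subseteq> X \<and> emeasure M V < \<infinity>"
  shows "sigma_finite_measure (M :: 'l::t2_space measure)"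
proof -
  obtain F :: "('l \<Rightarrow> real) set" where F: "countable F"
    "\<And>V x. open V \<Longrightarrow> x \<in> V \<Longrightarrow> \<exists>f\<in>F. test_function V f \<and> 0 < f x"
    using countable_test_function_base[OF lc sep] by metis
  define pos where "pos = (\<lambda>f :: 'l \<Rightarrow> real. {x. 0 < f x})"
  have pos_open: "open (pos f)" if "test_function V f" for V f
    unfolding pos_def using test_function_continuous[OF that] by (intro open_Collect_less continuous_intros)
  have pos_sub: "pos f \<subseteq> V" if "test_function V f" for V f
    using test_function_outside[OF that] by (force simp: pos_def)
  define good where "good V \<longleftrightarrow> open V \<and> V \<subseteq> X \<and> emeasure M V < \<infinity>" for V
  define A where "A = pos ` {f \<in> F. \<exists>V. good V \<and> test_function V f}"
  have sp: "space M = X" using sets_eq_imp_space_eq[OF X(2)] by (simp add: space_restrict_space)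
  have mem: "pos f \<in> sets M \<and> emeasure M (pos f) < \<infinity>" if f: "good V" "test_function V f" for f V
  proof -
    have V: "V \<in> sets M" "pos f \<in> sets M"
      using f pos_open[OF f(2)] pos_sub[OF f(2)] open_sets_restrict_space_borel[OF X]
      unfolding good_def by blast+
    have "emeasure M (pos f) \<le> emeasure M V" using pos_sub[OF f(2)] V(1) by (rule emeasure_mono)
    then show ?thesis using V f(1) unfolding good_def by (auto intro: le_less_trans)
  qed
  have "X \<subseteq> \<Union>A"
  proof
    fix x assume "x \<in> X"
    then obtain V where V: "x \<in> V" "good V" using local unfolding good_def by blast
    then obtain f where "f \<in> F" "test_function V f" "0 < f x" using F(2) unfolding good_def by blast
    then show "x \<in> \<Union>A" using V unfolding A_def pos_def by blast
  qed
  moreover have "\<Union>A \<subseteq> X" using pos_sub unfolding A_def good_def by blast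
  moreover have "countable A" unfolding A_def using F(1) by (intro countable_image) simp
  moreover have "A \<subseteq> sets M" "\<forall>a\<in>A. emeasure M a \<noteq> \<infinity>"
    using mem unfolding A_def by fastforce+
  ultimately show ?thesis by (intro sigma_finite_measure.intro exI[of _ A]) (auto simp: sp)
qed

text \<open>The truncated multiples \<open>min 1 (k f)\<close> increase to the indicator function of the set where \<open>f\<close> is
  positive.\<close>

lemma emeasure_positivity_set:
  fixes f :: "'l \<Rightarrow> real"
  assumes "f \<in> borel_measurable M" "\<And>x. 0 \<le> f x"
  shows "emeasure M ({x. 0 < f x} \<inter> space M) = (SUP k. \<integral>\<^sup>+x. ennreal (min 1 (real k * f x)) \<partial>M)"
proof -
  have "(SUP k. ennreal (min 1 (real k * f x))) = indicator {x. 0 < f x} x" for x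
  proof (cases "f x = 0")
    case False
    then have pos: "0 < f x" using assms(2)[of x] by simp
    then obtain k :: nat where "1 \<le> real k * f x"
      by (metis reals_Archimedean3 less_imp_le)
    then have "ennreal (min 1 (real k * f x)) = 1" by simp
    then have "1 \<le> (SUP k. ennreal (min 1 (real k * f x)))" by (metis SUP_upper UNIV_I)
    moreover have "(SUP k. ennreal (min 1 (real k * f x))) \<le> 1"
      by (rule SUP_least) (simp add: ennreal_le_1)
    ultimately show ?thesis using pos by simp
  qed simp
  then have "(\<integral>\<^sup>+x. indicator {x. 0 < f x} x \<partial>M) = (\<integral>\<^sup>+x. (SUP k. ennreal (min 1 (real k * f x))) \<partial>M)"
    by simp
  also have "\<dots> = (SUP k. \<integral>\<^sup>+x. ennreal (min 1 (real k * f x)) \<partial>M)"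
    using assms
    by (intro nn_integral_monotone_convergence_SUP)
      (auto simp: incseq_def le_fun_def intro!: ennreal_leI min.mono min.coboundedI2 mult_right_mono)
  finally show ?thesis
    using assms(1) by (simp add: nn_integral_indicator' Int_commute)
qed

text \<open>The sets of positivity of nonnegative test functions with small support are stable under
  intersection, by multiplying the functions, and they generate the Borel sets.\<close>

lemma measure_eqI_test_functions:
  assumes lc: "locally_compact_space (euclidean :: 'l::t2_space topology)"
    and sep: "separable_C0 TYPE('l::t2_space)"
    and X: "open X"
    and M: "sets M = sets (restrict_space borel X)" and N: "sets N = sets (restrict_space borel X)"
    and local: "\<And>x. x \<in> X \<Longrightarrow> \<exists>V. open V \<and> x \<in> V \<and> V \<subseteq> X \<and> emeasure M V < \<infinity> \<and>
      (\<forall>f :: 'l::t2_space \<Rightarrow> real. test_function V f \<longrightarrow> (\<forall>y. 0 \<le> f y) \<longrightarrow>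
        (\<integral>\<^sup>+y. ennreal (f y) \<partial>M) = (\<integral>\<^sup>+y. ennreal (f y) \<partial>N))"
  shows "M = (N :: 'l::t2_space measure)"
proof -
  obtain F :: "('l \<Rightarrow> real) set" where F: "countable F" "\<And>f x. f \<in> F \<Longrightarrow> 0 \<le> f x"
    "\<And>V x. open V \<Longrightarrow> x \<in> V \<Longrightarrow> \<exists>f\<in>F. test_function V f \<and> 0 < f x"
    using countable_test_function_base[OF lc sep] by metis
  define good where "good V \<longleftrightarrow> open V \<and> V \<subseteq> X \<and> emeasure M V < \<infinity> \<and>
      (\<forall>f :: 'l \<Rightarrow> real. test_function V f \<longrightarrow> (\<forall>y. 0 \<le> f y) \<longrightarrow>
        (\<integral>\<^sup>+y. ennreal (f y) \<partial>M) = (\<integral>\<^sup>+y. ennreal (f y) \<partial>N))" for V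
  have good_at: "\<exists>V. x \<in> V \<and> good V" if "x \<in> X" for x
    using local[OF that] unfolding good_def by (elim exE conjE) (intro exI conjI)
  define pos where "pos = (\<lambda>f :: 'l \<Rightarrow> real. {x. 0 < f x})"
  have pos_open: "open (pos f)" if "test_function V f" for V f
    unfolding pos_def using test_function_continuous[OF that] by (intro open_Collect_less continuous_intros)
  have pos_sub: "pos f \<subseteq> V" if "test_function V f" for V f
    using test_function_outside[OF that] by (force simp: pos_def)
  define G where "G = {pos f | f. (\<forall>x. 0 \<le> f x) \<and> (\<exists>V. good V \<and> test_function V f)}"
  have spM: "space M = X" using sets_eq_imp_space_eq[OF M] by (simp add: space_restrict_space)
  have spN: "space N = X" using sets_eq_imp_space_eq[OF N] by (simp add: space_restrict_space)
  \<comment> \<open>every open subset of \<open>X\<close> is a countable union of members of \<open>G\<close>\<close>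
  have cover: "\<exists>A. countable A \<and> A \<subseteq> G \<and> \<Union>A = W" if W: "open W" "W \<subseteq> X" for W
  proof (intro exI conjI)
    define A where "A = pos ` {f \<in> F. \<exists>V. good V \<and> test_function (V \<inter> W) f}"
    show "countable A" unfolding A_def using F(1) by (intro countable_image) simp
    show "A \<subseteq> G"
    proof
      fix a assume "a \<in> A"
      then obtain f V where f: "a = pos f" "f \<in> F" "good V" "test_function (V \<inter> W) f"
        unfolding A_def by blast
      then have "test_function V f" using test_function_mono by blast
      then show "a \<in> G" unfolding G_def using F(2) f by blast
    qed
    show "\<Union>A = W"
    proof
      show "\<Union>A \<subseteq> W" using pos_sub unfolding A_def by blast
      show "W \<subseteq> \<Union>A"
      proof
        fix x assume x: "x \<in> W"
        then obtain V where V: "x \<in> V" "good V" using good_at W(2) by blast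
        then have "open (V \<inter> W)" using W(1) unfolding good_def by (metis open_Int)
        then obtain f where "f \<in> F" "test_function (V \<inter> W) f" "0 < f x" using F(3) x V(1) by blast
        then show "x \<in> \<Union>A" using V unfolding A_def pos_def by blast
      qed
    qed
  qed
  have G_open: "open W \<and> W \<subseteq> X" if "W \<in> G" for W
    using that pos_open pos_sub unfolding G_def good_def by blast
  have "Int_stable G"
  proof (rule Int_stableI)
    fix a b assume "a \<in> G" "b \<in> G"
    then obtain f g V V' where f: "a = pos f" "\<forall>x. 0 \<le> f x" "good V" "test_function V f"
      and g: "b = pos g" "\<forall>x. 0 \<le> g x" "test_function V' g" unfolding G_def by blast
    have "test_function V (\<lambda>x. g x * f x)"
      using f test_function_continuous[OF g(3)] by (intro test_function_times) (auto simp: good_def)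
    moreover have "a \<inter> b = pos (\<lambda>x. g x * f x)"
      using f(2) g(2) unfolding f(1) g(1) pos_def by (auto simp: zero_less_mult_iff less_le)
    ultimately show "a \<inter> b \<in> G" unfolding G_def using f(2,3) g(2) by fastforce
  qed
  moreover have gen: "sets (restrict_space borel X) = sigma_sets X G"
  proof -
    have "sets (restrict_space borel X) = (\<inter>) X ` sigma_sets UNIV {S :: 'l set. open S}"
      by (simp add: sets_restrict_space borel_def)
    also have "\<dots> = sigma_sets X ((\<inter>) X ` {S. open S})"
      using X by (intro sigma_sets_Int sigma_sets.Basic) auto
    also have "\<dots> = sigma_sets X G"
    proof (rule sigma_sets_eqI)
      fix a assume "a \<in> (\<inter>) X ` {S. open S}"
      then obtain O' where "open O'" "a = X \<inter> O'" by blast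
      then have a: "open a" "a \<subseteq> X" using X by (simp_all add: open_Int)
      obtain A where A: "countable A" "A \<subseteq> G" "\<Union>A = a" using cover[OF a] by blast
      have "\<Union>A \<in> sigma_sets X G"
        by (rule sigma_sets_UNION[OF A(1)]) (use A(2) in \<open>auto intro: sigma_sets.Basic\<close>)
      then show "a \<in> sigma_sets X G" by (simp only: A(3))
    next
      fix b assume "b \<in> G"
      then show "b \<in> sigma_sets X ((\<inter>) X ` {S. open S})"
        using G_open by (intro sigma_sets.Basic) blast
    qed
    finally show ?thesis .
  qed
  moreover have "emeasure M a = emeasure N a" if a: "a \<in> G" for a
  proof -
    obtain f V where f: "a = pos f" "\<And>x. 0 \<le> f x" "good V" "test_function V f"
      using a unfolding G_def by blast
    have aX: "a \<inter> X = a" using G_open[OF a] by blast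
    have "f \<in> borel_measurable borel"
      by (rule borel_measurable_continuous_onI[OF test_function_continuous[OF f(4)]])
    then have meas: "f \<in> borel_measurable M" "f \<in> borel_measurable N"
      by (simp_all add: measurable_cong_sets[OF M refl] measurable_cong_sets[OF N refl]
          measurable_restrict_space1)
    have "(\<integral>\<^sup>+x. ennreal (min 1 (real k * f x)) \<partial>M) = (\<integral>\<^sup>+x. ennreal (min 1 (real k * f x)) \<partial>N)" for k
    proof -
      have "test_function V (\<lambda>x. min 1 (real k * f x))"
        using f(4) unfolding test_function_def by (auto intro!: continuous_intros)
      then show ?thesis using f(2,3) unfolding good_def by simp
    qed
    then show ?thesis
      using emeasure_positivity_set[OF meas(1) f(2)] emeasure_positivity_set[OF meas(2) f(2)] aX
      by (simp add: spM spN f(1) pos_def)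
  qed
  moreover have "emeasure M a \<noteq> \<infinity>" if a: "a \<in> G" for a
  proof -
    obtain f V where f: "a = pos f" "good V" "test_function V f" using a unfolding G_def by blast
    have "V \<in> sets M" using f(2) open_sets_restrict_space_borel[OF X M] unfolding good_def by blast
    then have "emeasure M a \<le> emeasure M V" using pos_sub[OF f(3)] f(1) by (intro emeasure_mono) auto
    then show ?thesis using f(2) unfolding good_def by auto
  qed
  moreover obtain A where "countable A" "A \<subseteq> G" "\<Union>A = X" using cover[OF X] by blast
  moreover have "G \<subseteq> Pow X" using G_open by blast
  ultimately show ?thesis
    by (intro measure_eqI_generator_eq_countable[where \<Omega>=X and E=G and A=A]) (auto simp: M N)
qed

text \<open>By Markov's inequality, on a neighbourhood where \<open>|f|\<close> stays away from zero.\<close>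

lemma finite_measure_near_nonzero:
  fixes f :: "'l::t2_space \<Rightarrow> complex"
  assumes X: "open X" "sets M = sets (restrict_space borel X)" and f: "continuous_on X f" "integrable M f"
    and x: "x \<in> X" "f x \<noteq> 0"
  shows "\<exists>V. open V \<and> x \<in> V \<and> V \<subseteq> X \<and> emeasure M V < \<infinity>"
proof -
  define c where "c = cmod (f x) / 2"
  define V where "V = X \<inter> (\<lambda>y. cmod (f y)) -` {c<..}"
  have c: "0 < c" "c < cmod (f x)" using x by (auto simp: c_def)
  have V: "open V" "x \<in> V" "V \<subseteq> X"
    using x c X(1) f(1) unfolding V_def
    by (auto intro!: continuous_open_preimage continuous_intros)
  have "emeasure M V = (\<integral>\<^sup>+y. indicator V y \<partial>M)"
    using open_sets_restrict_space_borel[OF X V(1,3)] by simp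
  also have "\<dots> \<le> (\<integral>\<^sup>+y. ennreal (norm (f y / c)) \<partial>M)"
  proof (rule nn_integral_mono)
    fix y show "indicator V y \<le> ennreal (norm (f y / c))"
      using c(1) by (auto simp: V_def norm_divide field_simps split: split_indicator)
  qed
  also have "\<dots> < \<infinity>" using integrable_divide[OF f(2), of c] by (simp add: integrable_iff_bounded)
  finally show ?thesis using V by blast
qed

section \<open>Continuous fields\<close>

lemma continuous_hfield_fibre:
  assumes "continuous_hfield X E" "l \<in> X"
  shows "hilbert_fibre (fibre E l) (fip E l)"
proof
  have "\<forall>l\<in>X. findim_hilbert (fibre E l) (fip E l)"
    using assms(1)[unfolded continuous_hfield_def] by (elim conjE)
  then show "findim_hilbert (fibre E l) (fip E l)" using assms(2) by (rule bspec)
qed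

lemma section_mem:
  assumes "continuous_hfield X E" "l \<in> X" "x \<in> sections E"
  shows "x l \<in> fibre E l"
proof -
  have "\<forall>x\<in>sections E. \<forall>l\<in>X. x l \<in> fibre E l"
    using assms(1)[unfolded continuous_hfield_def] by (elim conjE)
  then show ?thesis using assms(2,3) by blast
qed

lemma sections_add:
  assumes "continuous_hfield X E" "x \<in> sections E" "y \<in> sections E"
  shows "(\<lambda>l. x l + y l) \<in> sections E"
proof -
  have "\<forall>x\<in>sections E. \<forall>y\<in>sections E. (\<lambda>l. x l + y l) \<in> sections E"
    using assms(1)[unfolded continuous_hfield_def] by (elim conjE)
  then show ?thesis using assms(2,3) by blast
qed

lemma sections_scale:
  assumes "continuous_hfield X E" "x \<in> sections E"
  shows "(\<lambda>l. c *\<^sub>C x l) \<in> sections E"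
proof -
  have "\<forall>c. \<forall>x\<in>sections E. (\<lambda>l. c *\<^sub>C x l) \<in> sections E"
    using assms(1)[unfolded continuous_hfield_def] by (elim conjE)
  then show ?thesis using assms(2) by blast
qed

text \<open>By polarization, as only the norms of sections are continuous by definition.\<close>

lemma continuous_on_fip:
  assumes E: "continuous_hfield X E" and x: "x \<in> sections E" and y: "y \<in> sections E"
  shows "continuous_on X (\<lambda>l. fip E l (x l) (y l))"
proof -
  define N where "N z l = (fnorm E l (z l))\<^sup>2" for z l
  have N_eq: "N z l = Re (fip E l (z l) (z l))" if "l \<in> X" "z \<in> sections E" for z l
    using hilbert_fibre.ip_self_nonneg[OF continuous_hfield_fibre[OF E that(1)] section_mem[OF E that]]
    by (simp add: N_def fnorm_def)
  have N_cont: "continuous_on X (N z)" if "z \<in> sections E" for z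
  proof -
    have "\<forall>x\<in>sections E. continuous_on X (\<lambda>l. fnorm E l (x l))"
      using E[unfolded continuous_hfield_def] by (elim conjE)
    then have "continuous_on X (\<lambda>l. fnorm E l (z l))" using that by (rule bspec)
    then have "continuous_on X (\<lambda>l. (fnorm E l (z l))\<^sup>2)" by (intro continuous_intros)
    then show ?thesis unfolding N_def .
  qed
  define p where "p l = x l + y l" for l
  define q where "q l = x l + \<i> *\<^sub>C y l" for l
  have p: "p \<in> sections E" unfolding p_def by (rule sections_add[OF E x y])
  have q: "q \<in> sections E" unfolding q_def by (rule sections_add[OF E x sections_scale[OF E y]])
  define r where "r l = complex_of_real ((N p l - N x l - N y l) / 2)
    - \<i> * complex_of_real ((N q l - N x l - N y l) / 2)" for l
  have "continuous_on X r" unfolding r_def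
    by (intro continuous_intros N_cont x y p q) auto
  moreover have "r l = fip E l (x l) (y l)" if l: "l \<in> X" for l
  proof -
    interpret hilbert_fibre "fibre E l" "fip E l" by (rule continuous_hfield_fibre[OF E l])
    have m: "x l \<in> fibre E l" "y l \<in> fibre E l" "\<i> *\<^sub>C y l \<in> fibre E l"
      using section_mem[OF E l] x y scale_mem by blast+
    have yx: "fip E l (y l) (x l) = cnj (fip E l (x l) (y l))" by (rule ip_commute[OF m(2,1)])
    have "N p l = N x l + N y l + 2 * Re (fip E l (x l) (y l))"
      unfolding N_eq[OF l p] N_eq[OF l x] N_eq[OF l y] p_def
      using m by (simp add: ip_add_left ip_add_right add_mem yx)
    moreover have "N q l = N x l + N y l - 2 * Im (fip E l (x l) (y l))"
      unfolding N_eq[OF l q] N_eq[OF l x] N_eq[OF l y] q_def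
      using m by (simp add: ip_add_left ip_add_right ip_scale_left ip_scale_right add_mem yx)
    ultimately show ?thesis unfolding r_def by (simp add: complex_eq_iff)
  qed
  ultimately show ?thesis by (rule continuous_on_eq)
qed

lemma section_continuous_on_subset:
  assumes E: "continuous_hfield X E" and x: "x \<in> sections E" and S: "S \<subseteq> X"
  shows "continuous_section_on E S x"
  unfolding continuous_section_on_def continuous_section_along_def id_apply
proof (intro conjI ballI allI impI)
  fix s assume "s \<in> S"
  then show "x s \<in> fibre E s" using S section_mem[OF E _ x] by blast
next
  fix s and e :: real assume s: "s \<in> S" and e: "0 < e"
  have "fnorm E r (x r - x r) < e" if "r \<in> S" for r
  proof -
    interpret hilbert_fibre "fibre E r" "fip E r" by (rule continuous_hfield_fibre[OF E]) (use that S in blast)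
    show ?thesis using e ip_zero_right[OF zero_mem] by (simp add: fnorm_def)
  qed
  then show "\<exists>y\<in>sections E. \<exists>V. open V \<and> s \<in> V \<and> (\<forall>r\<in>V \<inter> S. fnorm E r (x r - y r) < e)"
    using x by (intro bexI[of _ x] exI[of _ UNIV]) auto
qed

lemma locally_trivial_frame:
  assumes E: "locally_trivial_hfield X E" and l: "l \<in> X"
  obtains V n e where "open V" "l \<in> V" "V \<subseteq> X" "\<And>m. m \<in> V \<Longrightarrow> cdim (fibre E m) = n"
    "\<And>m. m \<in> V \<Longrightarrow> hilbert_fibre.orthonormal (fibre E m) (fip E m) n (\<lambda>i. e i m)"
proof -
  have E': "continuous_hfield X E" using E[unfolded locally_trivial_hfield_def] by (elim conjE)
  from E[unfolded locally_trivial_hfield_def, THEN conjunct2, THEN bspec, OF l]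
  obtain V and n :: nat and e where V: "open V" "l \<in> V" "V \<subseteq> X"
    and frame: "\<forall>m\<in>V. fibre E m = cspan ((\<lambda>i. e i m) ` {..<n}) \<and>
      (\<forall>i<n. \<forall>j<n. fip E m (e i m) (e j m) = (if i = j then 1 else 0))"
    by (elim exE conjE) (rule that, assumption+)
  note e = frame[THEN bspec, THEN conjunct1] frame[THEN bspec, THEN conjunct2]
  have on: "hilbert_fibre.orthonormal (fibre E m) (fip E m) n (\<lambda>i. e i m)" if m: "m \<in> V" for m
  proof -
    interpret hilbert_fibre "fibre E m" "fip E m"
      by (rule continuous_hfield_fibre[OF E']) (use V m in blast)
    have "\<forall>i<n. e i m \<in> fibre E m"
      unfolding e(1)[OF m] by (auto intro: complex_vector.span_base)
    then show ?thesis unfolding orthonormal_def using e(2)[OF m] by blast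
  qed
  show ?thesis
  proof (rule that[OF V _ on])
    fix m assume m: "m \<in> V"
    interpret hilbert_fibre "fibre E m" "fip E m"
      by (rule continuous_hfield_fibre[OF E']) (use V m in blast)
    show "cdim (fibre E m) = n" by (rule orthonormal_spanning_cdim[OF on[OF m] e(1)[OF m]])
  qed
qed

section \<open>Asymptotic containment\<close>

locale asymptotic_containment =
  fixes \<pi> :: "('l::t2_space \<Rightarrow> complex) \<Rightarrow> 'h::chilbert_space \<Rightarrow> 'h"
    and \<pi>0 :: "('l \<Rightarrow> complex) \<Rightarrow> 'h0::chilbert_space \<Rightarrow> 'h0"
    and U :: "real \<Rightarrow> 'h0 \<Rightarrow> 'h0"
    and W :: "'h0 \<Rightarrow> 'h"
    and \<Lambda>0 :: "'l set"
    and E0 :: "('l, 'e::complex_vector) hfield"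
    and D0 :: "'h0 set"
    and ev0 :: "'h0 \<Rightarrow> 'l \<Rightarrow> 'e"
    and \<mu>0 :: "'l measure"
    and UF :: "real \<Rightarrow> 'l \<Rightarrow> 'e \<Rightarrow> 'e"
    and E :: "('l, 'f::complex_vector) hfield"
    and D :: "'h set"
    and ev :: "'h \<Rightarrow> 'l \<Rightarrow> 'f"
    and \<mu> :: "'l measure"
    and C :: "'l \<Rightarrow> 'f \<Rightarrow> 'e"
  assumes containment: "asymptotically_contained_via \<pi>0 \<pi> U W"
    and A: "assumption_A \<pi>0 \<Lambda>0 E0 D0 ev0 \<mu>0"
    and B: "assumption_B U \<Lambda>0 E0 D0 ev0 UF"
    and C: "assumption_C \<pi> U W D0 E D ev \<mu>"
    and D: "assumption_D U W \<Lambda>0 E0 D0 ev0 E ev C"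
begin

lemma open_base: "open \<Lambda>0"
  and trivial0: "locally_trivial_hfield \<Lambda>0 E0"
  and ev0_section: "h \<in> D0 \<Longrightarrow> ev0 h \<in> sections E0"
  and sets_\<mu>0: "sets \<mu>0 = sets (restrict_space borel \<Lambda>0)"
  and integrable0: "h \<in> D0 \<Longrightarrow> g \<in> D0 \<Longrightarrow> integrable \<mu>0 (\<lambda>l. fip E0 l (ev0 h l) (ev0 g l))"
  and cinner0: "h \<in> D0 \<Longrightarrow> g \<in> D0 \<Longrightarrow> a \<in> C0 \<Longrightarrow>
    cinner h (\<pi>0 a g) = (\<integral>l. fip E0 l (ev0 h l) (ev0 g l) * a l \<partial>\<mu>0)"
  and ev0_fibre: "l \<in> \<Lambda>0 \<Longrightarrow> fibre E0 l = {ev0 h l | h. h \<in> D0}"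
  using A unfolding assumption_A_def by simp_all

lemma ev0_surj: "l \<in> \<Lambda>0 \<Longrightarrow> w \<in> fibre E0 l \<Longrightarrow> \<exists>h\<in>D0. ev0 h l = w"
  using ev0_fibre[of l] by auto

lemma field0: "continuous_hfield \<Lambda>0 E0"
  using trivial0[unfolded locally_trivial_hfield_def] by (elim conjE)

lemma fibre0: "l \<in> \<Lambda>0 \<Longrightarrow> hilbert_fibre (fibre E0 l) (fip E0 l)"
  by (rule continuous_hfield_fibre[OF field0])

lemma ev0_mem: "l \<in> \<Lambda>0 \<Longrightarrow> h \<in> D0 \<Longrightarrow> ev0 h l \<in> fibre E0 l"
  by (rule section_mem[OF field0 _ ev0_section])

lemma U_D0: "h \<in> D0 \<Longrightarrow> U t h \<in> D0"
  using B unfolding assumption_B_def by blast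

lemma UF_ev0: "h \<in> D0 \<Longrightarrow> l \<in> \<Lambda>0 \<Longrightarrow> UF t l (ev0 h l) = ev0 (U t h) l"
  using B unfolding assumption_B_def by simp

lemma UF_mem: "l \<in> \<Lambda>0 \<Longrightarrow> v \<in> fibre E0 l \<Longrightarrow> UF t l v \<in> fibre E0 l"
  and UF_isometry: "l \<in> \<Lambda>0 \<Longrightarrow> v \<in> fibre E0 l \<Longrightarrow> w \<in> fibre E0 l \<Longrightarrow>
    fip E0 l (UF t l v) (UF t l w) = fip E0 l v w"
  and UF_add: "l \<in> \<Lambda>0 \<Longrightarrow> v \<in> fibre E0 l \<Longrightarrow> w \<in> fibre E0 l \<Longrightarrow>
    UF t l (v + w) = UF t l v + UF t l w"
  and UF_scale: "l \<in> \<Lambda>0 \<Longrightarrow> v \<in> fibre E0 l \<Longrightarrow> UF t l (c *\<^sub>C v) = c *\<^sub>C UF t l v"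
proof -
  have *: "\<forall>l\<in>\<Lambda>0. \<forall>t. clinear_on (fibre E0 l) (UF t l) \<and> UF t l ` fibre E0 l = fibre E0 l \<and>
      (\<forall>v\<in>fibre E0 l. \<forall>w\<in>fibre E0 l. fip E0 l (UF t l v) (UF t l w) = fip E0 l v w)"
    using B[unfolded assumption_B_def] by (elim conjE)
  note * = *[THEN bspec, THEN spec]
  show "l \<in> \<Lambda>0 \<Longrightarrow> v \<in> fibre E0 l \<Longrightarrow> UF t l v \<in> fibre E0 l"
    using *[of l t] by blast
  show "l \<in> \<Lambda>0 \<Longrightarrow> v \<in> fibre E0 l \<Longrightarrow> w \<in> fibre E0 l \<Longrightarrow>
      fip E0 l (UF t l v) (UF t l w) = fip E0 l v w"
    using *[of l t] by blast
  show "l \<in> \<Lambda>0 \<Longrightarrow> v \<in> fibre E0 l \<Longrightarrow> w \<in> fibre E0 l \<Longrightarrow>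
      UF t l (v + w) = UF t l v + UF t l w"
    using *[of l t, THEN conjunct1] unfolding clinear_on_def by blast
  show "l \<in> \<Lambda>0 \<Longrightarrow> v \<in> fibre E0 l \<Longrightarrow> UF t l (c *\<^sub>C v) = c *\<^sub>C UF t l v"
    using *[of l t, THEN conjunct1] unfolding clinear_on_def by blast
qed

lemma trivial: "locally_trivial_hfield UNIV E"
  and dim_fibre: "cdim (fibre E l) = 1"
  and W_U_mem: "u \<in> D0 \<Longrightarrow> \<forall>\<^sub>F t in at_top. W (U t u) \<in> D"
  and ev_section: "h \<in> D \<Longrightarrow> ev h \<in> sections E"
  and sets_\<mu>: "sets \<mu> = sets borel"
  and integrable_ev: "h \<in> D \<Longrightarrow> g \<in> D \<Longrightarrow> integrable \<mu> (\<lambda>l. fip E l (ev h l) (ev g l))"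
  and cinner_ev: "h \<in> D \<Longrightarrow> g \<in> D \<Longrightarrow> a \<in> C0 \<Longrightarrow>
    cinner h (\<pi> a g) = (\<integral>l. fip E l (ev h l) (ev g l) * a l \<partial>\<mu>)"
  using C unfolding assumption_C_def by simp_all

lemma field: "continuous_hfield UNIV E"
  using trivial[unfolded locally_trivial_hfield_def] by (elim conjE)

lemma fibre: "hilbert_fibre (fibre E l) (fip E l)"
  by (rule continuous_hfield_fibre[OF field UNIV_I])

lemma ev_mem: "h \<in> D \<Longrightarrow> ev h l \<in> fibre E l"
  by (rule section_mem[OF field UNIV_I ev_section])

lemma C_linear: "l \<in> \<Lambda>0 \<Longrightarrow> clinear_on (fibre E l) (C l)"
  and C_image: "l \<in> \<Lambda>0 \<Longrightarrow> C l ` fibre E l \<subseteq> fibre E0 l"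
  and C_inj: "l \<in> \<Lambda>0 \<Longrightarrow> inj_on (C l) (fibre E l)"
  using D unfolding assumption_D_def by simp_all

lemma C_mem: "l \<in> \<Lambda>0 \<Longrightarrow> v \<in> fibre E l \<Longrightarrow> C l v \<in> fibre E0 l"
  using C_image by blast

lemma C_nonzero:
  assumes l: "l \<in> \<Lambda>0" and v: "v \<in> fibre E l" "v \<noteq> 0"
  shows "C l v \<noteq> 0"
proof
  assume eq: "C l v = 0"
  interpret hilbert_fibre "fibre E l" "fip E l" by (rule fibre)
  have "C l (0 *\<^sub>C v) = 0 *\<^sub>C C l v"
    using C_linear[OF l] v unfolding clinear_on_def by blast
  then have "C l 0 = C l v" by (simp add: eq)
  then show False using C_inj[OF l] zero_mem v unfolding inj_on_def by blast
qed

lemma C_section: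
  assumes "v \<in> sections E"
  shows "(\<lambda>l. C l (v l)) \<in> sections E0"
proof -
  have "continuous_section_on E \<Lambda>0 v"
    by (rule section_continuous_on_subset[OF field assms]) simp
  moreover have "\<forall>v. continuous_section_on E \<Lambda>0 v \<longrightarrow> continuous_section_on E0 \<Lambda>0 (\<lambda>l. C l (v l))"
    using D[unfolded assumption_D_def] by (elim conjE)
  moreover have "\<forall>z. continuous_section_on E0 \<Lambda>0 z \<longrightarrow> z \<in> sections E0"
    using field0[unfolded continuous_hfield_def] by (elim conjE)
  ultimately show ?thesis by blast
qed

lemma pairing_close:
  assumes "h \<in> D0" "v \<in> sections E" "compact K" "K \<subseteq> \<Lambda>0" and e: "0 < e"
  shows "\<forall>\<^sub>F t in at_top. \<forall>l\<in>K. cmod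
    (fip E0 l (C l (v l)) (ev0 (U t h) l) - fip E l (v l) (ev (W (U t h)) l)) < e"
proof -
  have "\<forall>h\<in>D0. \<forall>v\<in>sections E. \<forall>K. compact K \<and> K \<subseteq> \<Lambda>0 \<longrightarrow>
      ((\<lambda>t. SUP l\<in>K. ennreal (cmod
          (fip E0 l (C l (v l)) (ev0 (U t h) l) - fip E l (v l) (ev (W (U t h)) l)))) \<longlongrightarrow> 0) at_top"
    using D[unfolded assumption_D_def] by (elim conjE)
  then have "((\<lambda>t. SUP l\<in>K. ennreal (cmod
          (fip E0 l (C l (v l)) (ev0 (U t h) l) - fip E l (v l) (ev (W (U t h)) l)))) \<longlongrightarrow> 0) at_top"
    using assms by blast
  then have "\<forall>\<^sub>F t in at_top. (SUP l\<in>K. ennreal (cmod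
          (fip E0 l (C l (v l)) (ev0 (U t h) l) - fip E l (v l) (ev (W (U t h)) l)))) < ennreal e"
    using e by (intro order_tendstoD(2)[where y=0]) simp_all
  then show ?thesis
  proof (rule eventually_mono, intro ballI)
    fix t l assume sup: "(SUP l\<in>K. ennreal (cmod
          (fip E0 l (C l (v l)) (ev0 (U t h) l) - fip E l (v l) (ev (W (U t h)) l)))) < ennreal e"
      and l: "l \<in> K"
    have "ennreal (cmod (fip E0 l (C l (v l)) (ev0 (U t h) l) - fip E l (v l) (ev (W (U t h)) l))) < ennreal e"
      by (rule le_less_trans[OF SUP_upper[OF l] sup])
    then show "cmod (fip E0 l (C l (v l)) (ev0 (U t h) l) - fip E l (v l) (ev (W (U t h)) l)) < e"
      by (simp add: ennreal_less_iff)
  qed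
qed

end

section \<open>Local frames\<close>

text \<open>The limit formula is available for the sections \<open>ev h\<close> and survives multiplication by continuous
  functions and addition. An orthonormal frame near a point consists of such combinations, although
  in general not of sections \<open>ev h\<close> themselves.\<close>

inductive_set local_span ::
    "'l::topological_space set \<Rightarrow> 'h0 set \<Rightarrow> ('h0 \<Rightarrow> 'l \<Rightarrow> 'e::complex_vector) \<Rightarrow> ('l \<Rightarrow> 'e) set"
  for V D ev where
    multiple: "h \<in> D \<Longrightarrow> continuous_on V c \<Longrightarrow> (\<lambda>l. c l *\<^sub>C ev h l) \<in> local_span V D ev"
  | add: "s \<in> local_span V D ev \<Longrightarrow> s' \<in> local_span V D ev \<Longrightarrow> (\<lambda>l. s l + s' l) \<in> local_span V D ev"

lemma local_span_mono:
  assumes "V' \<subseteq> V" "s \<in> local_span V D ev"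
  shows "s \<in> local_span V' D ev"
  using assms(2)
proof (induction rule: local_span.induct)
  case (multiple h c)
  then show ?case using continuous_on_subset[OF _ assms(1)] by (intro local_span.multiple) auto
next
  case (add s s')
  then show ?case by (intro local_span.add)
qed

lemma local_span_scale:
  assumes f: "continuous_on V f" and s: "s \<in> local_span V D ev"
  shows "(\<lambda>l. f l *\<^sub>C s l) \<in> local_span V D ev"
  using s
proof (induction rule: local_span.induct)
  case (multiple h c)
  have "(\<lambda>l. (f l * c l) *\<^sub>C ev h l) \<in> local_span V D ev"
    using multiple f by (intro local_span.multiple continuous_intros)
  then show ?case by (simp add: scaleC_scaleC)
next
  case (add s s')
  then have "(\<lambda>l. f l *\<^sub>C s l + f l *\<^sub>C s' l) \<in> local_span V D ev" by (intro local_span.add)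
  then show ?case by (simp add: scaleC_add_right)
qed

lemma local_span_add_sum:
  fixes n :: nat
  assumes s: "s \<in> local_span V D ev" and "\<And>i. i < n \<Longrightarrow> continuous_on V (f i)"
    and "\<And>i. i < n \<Longrightarrow> u i \<in> local_span V D ev"
  shows "(\<lambda>l. s l + (\<Sum>i<n. f i l *\<^sub>C u i l)) \<in> local_span V D ev"
  using assms(2,3)
proof (induction n)
  case 0
  then show ?case using s by simp
next
  case (Suc n)
  have "(\<lambda>l. (s l + (\<Sum>i<n. f i l *\<^sub>C u i l)) + f n l *\<^sub>C u n l) \<in> local_span V D ev"
    by (intro local_span.add local_span_scale Suc) (auto simp: Suc.prems)
  then show ?case by (simp add: add.assoc)
qed

context asymptotic_containment
begin

abbreviation LS :: "'l set \<Rightarrow> ('l \<Rightarrow> 'e) set"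
  where "LS V \<equiv> local_span V D0 ev0"

definition pairing :: "('l \<Rightarrow> 'f) \<Rightarrow> real \<Rightarrow> ('l \<Rightarrow> 'e) \<Rightarrow> 'l \<Rightarrow> complex"
  where "pairing v t s l = fip E0 l (C l (v l)) (UF t l (s l))"

lemma ev0_local_span: "h \<in> D0 \<Longrightarrow> ev0 h \<in> LS V"
  using local_span.multiple[of h D0 V "\<lambda>_. 1" ev0] by (simp add: scaleC_one)

lemma local_span_mem:
  assumes "s \<in> LS V" "l \<in> \<Lambda>0"
  shows "s l \<in> fibre E0 l"
  using assms(1)
proof (induction rule: local_span.induct)
  case (multiple h c)
  then show ?case using hilbert_fibre.scale_mem[OF fibre0[OF assms(2)]] ev0_mem[OF assms(2)] by blast
next
  case (add s s')
  then show ?case using hilbert_fibre.add_mem[OF fibre0[OF assms(2)]] by blast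
qed

lemma continuous_fip_local_span:
  assumes V: "V \<subseteq> \<Lambda>0" and s: "s \<in> LS V" and s': "s' \<in> LS V"
  shows "continuous_on V (\<lambda>l. fip E0 l (s l) (s' l))"
proof -
  have with_ev0: "continuous_on V (\<lambda>l. fip E0 l (ev0 h l) (s' l))" if h: "h \<in> D0" for h
    using s'
  proof (induction rule: local_span.induct)
    case (multiple g c)
    have "continuous_on V (\<lambda>l. c l * fip E0 l (ev0 h l) (ev0 g l))"
      using multiple h V by (intro continuous_intros continuous_on_subset[OF continuous_on_fip[OF field0]] ev0_section)
    then show ?case
    proof (rule continuous_on_eq)
      fix l assume "l \<in> V"
      then show "c l * fip E0 l (ev0 h l) (ev0 g l) = fip E0 l (ev0 h l) (c l *\<^sub>C ev0 g l)"
        using V h multiple by (intro hilbert_fibre.ip_scale_right[OF fibre0, symmetric] ev0_mem) auto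
    qed
  next
    case (add s s')
    have "continuous_on V (\<lambda>l. fip E0 l (ev0 h l) (s l) + fip E0 l (ev0 h l) (s' l))"
      by (intro continuous_intros add)
    then show ?case
    proof (rule continuous_on_eq)
      fix l assume "l \<in> V"
      then show "fip E0 l (ev0 h l) (s l) + fip E0 l (ev0 h l) (s' l) = fip E0 l (ev0 h l) (s l + s' l)"
        using V h add by (intro hilbert_fibre.ip_add_right[OF fibre0, symmetric] ev0_mem local_span_mem) auto
    qed
  qed
  show ?thesis
    using s
  proof (induction rule: local_span.induct)
    case (multiple g c)
    have "continuous_on V (\<lambda>l. cnj (c l) * fip E0 l (ev0 g l) (s' l))"
      using multiple by (intro continuous_intros with_ev0)
    then show ?case
    proof (rule continuous_on_eq)
      fix l assume "l \<in> V"
      then show "cnj (c l) * fip E0 l (ev0 g l) (s' l) = fip E0 l (c l *\<^sub>C ev0 g l) (s' l)"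
        using V s' multiple by (intro hilbert_fibre.ip_scale_left[OF fibre0, symmetric] ev0_mem local_span_mem) auto
    qed
  next
    case (add r s)
    have "continuous_on V (\<lambda>l. fip E0 l (r l) (s' l) + fip E0 l (s l) (s' l))"
      by (intro continuous_intros add)
    then show ?case
    proof (rule continuous_on_eq)
      fix l assume "l \<in> V"
      then show "fip E0 l (r l) (s' l) + fip E0 l (s l) (s' l) = fip E0 l (r l + s l) (s' l)"
        using V s' add by (intro hilbert_fibre.ip_add_left[OF fibre0, symmetric] local_span_mem) auto
    qed
  qed
qed

lemma pairing_scale:
  assumes "l \<in> \<Lambda>0" "v l \<in> fibre E l" "s l \<in> fibre E0 l"
  shows "pairing v t (\<lambda>l. c l *\<^sub>C s l) l = c l * pairing v t s l"
  using assms unfolding pairing_def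
  by (simp add: UF_scale UF_mem C_mem hilbert_fibre.ip_scale_right[OF fibre0])

lemma pairing_add:
  assumes "l \<in> \<Lambda>0" "v l \<in> fibre E l" "s l \<in> fibre E0 l" "s' l \<in> fibre E0 l"
  shows "pairing v t (\<lambda>l. s l + s' l) l = pairing v t s l + pairing v t s' l"
  using assms unfolding pairing_def
  by (simp add: UF_add UF_mem C_mem hilbert_fibre.ip_add_right[OF fibre0])

text \<open>On \<open>ev0 h\<close> the fibrewise flow is the flow on \<open>H\<^sub>0\<close>, so it carries \<open>ev0 h\<close> to the continuous
  section \<open>ev0 (U t h)\<close>.\<close>

lemma continuous_pairing:
  assumes V: "V \<subseteq> \<Lambda>0" and v: "v \<in> sections E" and s: "s \<in> LS V"
  shows "continuous_on V (pairing v t s)"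
  using s
proof (induction rule: local_span.induct)
  case (multiple h c)
  have "continuous_on V (\<lambda>l. c l * fip E0 l (C l (v l)) (ev0 (U t h) l))"
    using multiple v V
    by (intro continuous_intros continuous_on_subset[OF continuous_on_fip[OF field0]]
        ev0_section U_D0 C_section)
  then show ?case
  proof (rule continuous_on_eq)
    fix l assume "l \<in> V"
    then have l: "l \<in> \<Lambda>0" using V by blast
    show "c l * fip E0 l (C l (v l)) (ev0 (U t h) l) = pairing v t (\<lambda>l. c l *\<^sub>C ev0 h l) l"
      using pairing_scale[where s="ev0 h" and v=v, OF l section_mem[OF field UNIV_I v] ev0_mem[OF l multiple(1)]]
      by (simp add: pairing_def UF_ev0[OF multiple(1) l])
  qed
next
  case (add s s')
  have "continuous_on V (\<lambda>l. pairing v t s l + pairing v t s' l)"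
    by (intro continuous_intros add)
  then show ?case
  proof (rule continuous_on_eq)
    fix l assume "l \<in> V"
    then have l: "l \<in> \<Lambda>0" using V by blast
    show "pairing v t s l + pairing v t s' l = pairing v t (\<lambda>l. s l + s' l) l"
      using add l by (intro pairing_add[symmetric] section_mem[OF field UNIV_I v] local_span_mem)
  qed
qed

lemma ev0_frame:
  assumes l: "l \<in> \<Lambda>0"
  obtains V h where "open V" "l \<in> V" "V \<subseteq> \<Lambda>0"
    "\<And>m. m \<in> V \<Longrightarrow> cdim (fibre E0 m) = cdim (fibre E0 l)"
    "\<And>i. i < cdim (fibre E0 l) \<Longrightarrow> h i \<in> D0"
    "hilbert_fibre.orthonormal (fibre E0 l) (fip E0 l) (cdim (fibre E0 l)) (\<lambda>i. ev0 (h i) l)"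
proof -
  obtain V and n :: nat and e where V: "open V" "l \<in> V" "V \<subseteq> \<Lambda>0"
    "\<And>m. m \<in> V \<Longrightarrow> cdim (fibre E0 m) = n"
    and e: "\<And>m. m \<in> V \<Longrightarrow> hilbert_fibre.orthonormal (fibre E0 m) (fip E0 m) n (\<lambda>i. e i m)"
    using locally_trivial_frame[OF trivial0 l] by metis
  interpret hilbert_fibre "fibre E0 l" "fip E0 l" by (rule fibre0[OF l])
  have "\<exists>h. i < n \<longrightarrow> h \<in> D0 \<and> ev0 h l = e i l" for i
  proof (cases "i < n")
    case True
    then have "e i l \<in> fibre E0 l" using e[OF V(2)] by (simp add: orthonormal_def)
    then show ?thesis using ev0_surj[OF l] by blast
  qed simp
  then obtain h where h: "\<And>i. i < n \<Longrightarrow> h i \<in> D0" "\<And>i. i < n \<Longrightarrow> ev0 (h i) l = e i l" by metis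
  have "orthonormal n (\<lambda>i. ev0 (h i) l)" using e[OF V(2)] h(2) unfolding orthonormal_def by simp
  then show ?thesis using that[of V h] V h(1) by simp
qed

text \<open>The sections are orthonormal at \<open>l0\<close>, so the process changes nothing there. Hence the residual
  \<open>r\<close> has norm one at \<open>l0\<close> and stays nonzero nearby; each step shrinks the neighbourhood
  accordingly.\<close>

lemma local_Gram_Schmidt:
  assumes l0: "l0 \<in> \<Lambda>0" and h: "\<And>i. i < n \<Longrightarrow> h i \<in> D0"
    and on: "hilbert_fibre.orthonormal (fibre E0 l0) (fip E0 l0) n (\<lambda>i. ev0 (h i) l0)"
  shows "\<exists>V u. open V \<and> l0 \<in> V \<and> V \<subseteq> \<Lambda>0 \<and> (\<forall>i<n. u i \<in> LS V) \<and>
    (\<forall>l\<in>V. hilbert_fibre.orthonormal (fibre E0 l) (fip E0 l) n (\<lambda>i. u i l))"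
proof -
  have "\<exists>V u. open V \<and> l0 \<in> V \<and> V \<subseteq> \<Lambda>0 \<and> (\<forall>i<k. u i \<in> LS V \<and> u i l0 = ev0 (h i) l0) \<and>
    (\<forall>l\<in>V. hilbert_fibre.orthonormal (fibre E0 l) (fip E0 l) k (\<lambda>i. u i l))" if "k \<le> n" for k
    using that
  proof (induction k)
    case 0
    then show ?case
      using l0 open_base hilbert_fibre.orthonormal_def[OF fibre0] by (intro exI[of _ \<Lambda>0]) auto
  next
    case (Suc k)
    then obtain V u where V: "open V" "l0 \<in> V" "V \<subseteq> \<Lambda>0"
      and u: "\<And>i. i < k \<Longrightarrow> u i \<in> LS V" "\<And>i. i < k \<Longrightarrow> u i l0 = ev0 (h i) l0"
      and onu: "\<And>l. l \<in> V \<Longrightarrow> hilbert_fibre.orthonormal (fibre E0 l) (fip E0 l) k (\<lambda>i. u i l)"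
      by (metis Suc_leD)
    have hk: "h k \<in> D0" using h Suc.prems by simp
    define r where "r l = ev0 (h k) l + (\<Sum>i<k. (- fip E0 l (u i l) (ev0 (h k) l)) *\<^sub>C u i l)" for l
    define q where "q l = Re (fip E0 l (r l) (r l))" for l
    have r: "r \<in> LS V" unfolding r_def
      by (intro local_span_add_sum ev0_local_span hk u continuous_intros continuous_fip_local_span V)
    have q: "continuous_on V q" unfolding q_def
      by (intro continuous_intros continuous_fip_local_span V r)
    interpret l0: hilbert_fibre "fibre E0 l0" "fip E0 l0" by (rule fibre0[OF l0])
    have "fip E0 l0 (u i l0) (ev0 (h k) l0) = 0" if "i < k" for i
      using on Suc.prems that u(2)[OF that] unfolding l0.orthonormal_def by auto
    then have rl0: "r l0 = ev0 (h k) l0" unfolding r_def by simp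
    then have ql0: "q l0 = 1" using on Suc.prems unfolding q_def l0.orthonormal_def by simp
    define V' where "V' = V \<inter> q -` {0<..}"
    have V': "open V'" "l0 \<in> V'" "V' \<subseteq> V" "\<And>l. l \<in> V' \<Longrightarrow> 0 < q l"
      using V q ql0 unfolding V'_def by (auto intro!: continuous_open_preimage)
    define u' where "u' = u(k := (\<lambda>l. complex_of_real (1 / sqrt (q l)) *\<^sub>C r l))"
    have "\<forall>l\<in>V'. sqrt (q l) \<noteq> 0" using V'(4) by force
    then have "continuous_on V' (\<lambda>l. complex_of_real (1 / sqrt (q l)))"
      using continuous_on_subset[OF q V'(3)] by (intro continuous_intros)
    then have "u' k \<in> LS V'" unfolding u'_def using local_span_scale local_span_mono[OF V'(3) r] by simp
    then have "\<forall>i<Suc k. u' i \<in> LS V'"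
      using local_span_mono[OF V'(3) u(1)] by (auto simp: u'_def less_Suc_eq)
    moreover have "\<forall>i<Suc k. u' i l0 = ev0 (h i) l0"
      using u(2) rl0 ql0 by (auto simp: u'_def less_Suc_eq scaleC_one)
    moreover have "\<forall>l\<in>V'. hilbert_fibre.orthonormal (fibre E0 l) (fip E0 l) (Suc k) (\<lambda>i. u' i l)"
    proof
      fix l assume l': "l \<in> V'"
      then have lV: "l \<in> V" and l: "l \<in> \<Lambda>0" using V V' by auto
      interpret hilbert_fibre "fibre E0 l" "fip E0 l" by (rule fibre0[OF l])
      have "orthonormal (Suc k) ((\<lambda>i. u i l)(k := complex_of_real (1 / sqrt (q l)) *\<^sub>C r l))"
        unfolding q_def
      proof (rule orthonormal_extend[OF onu[OF lV] local_span_mem[OF r l]])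
        show "0 < Re (fip E0 l (r l) (r l))" using V'(4)[OF l'] by (simp add: q_def)
        show "fip E0 l (u i l) (r l) = 0" if "i < k" for i
          unfolding r_def by (rule orthonormal_residual[OF onu[OF lV] ev0_mem[OF l hk] that])
      qed
      moreover have "(\<lambda>i. u' i l) = (\<lambda>i. u i l)(k := complex_of_real (1 / sqrt (q l)) *\<^sub>C r l)"
        by (auto simp: u'_def)
      ultimately show "orthonormal (Suc k) (\<lambda>i. u' i l)" by simp
    qed
    ultimately show ?case using V V' by (intro exI[of _ V'] exI[of _ u']) auto
  qed
  from this[OF order_refl] show ?thesis by blast
qed

section \<open>Finiteness of the measures near each point\<close>

lemma nonzero_section:
  obtains v where "v \<in> sections E" "v l \<noteq> 0"
proof -
  interpret hilbert_fibre "fibre E l" "fip E l" by (rule fibre)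
  obtain u where u: "u \<in> fibre E l" "u \<noteq> 0" using line_generator[OF dim_fibre] by metis
  have u': "- u = (-1) *\<^sub>C u" by (simp add: scaleC_one)
  then have mem: "- u \<in> fibre E l" using u scale_mem by metis
  have "0 < fnorm E l (- u)" using ip_pos[OF mem] u by (simp add: fnorm_def)
  moreover have "\<forall>l\<in>UNIV. \<forall>v\<in>fibre E l. \<forall>e>0. \<exists>x\<in>sections E. fnorm E l (x l - v) < e"
    using field[unfolded continuous_hfield_def] by (elim conjE)
  ultimately obtain x where x: "x \<in> sections E" "fnorm E l (x l - u) < fnorm E l (- u)"
    using u(1) by blast
  then have "x l \<noteq> 0" by auto
  then show ?thesis using that x(1) by blast
qed

lemma locally_finite_\<mu>0:
  assumes l: "l \<in> \<Lambda>0" and dim: "0 < cdim (fibre E0 l)"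
  shows "\<exists>V. open V \<and> l \<in> V \<and> V \<subseteq> \<Lambda>0 \<and> emeasure \<mu>0 V < \<infinity>"
proof -
  interpret hilbert_fibre "fibre E0 l" "fip E0 l" by (rule fibre0[OF l])
  obtain V h where h: "h 0 \<in> D0" "orthonormal (cdim (fibre E0 l)) (\<lambda>i. ev0 (h i) l)"
    using ev0_frame[OF l] dim by metis
  then have "fip E0 l (ev0 (h 0) l) (ev0 (h 0) l) \<noteq> 0" using dim by (simp add: orthonormal_def)
  then show ?thesis
    by (intro finite_measure_near_nonzero[OF open_base sets_\<mu>0 _ integrable0[OF h(1) h(1)] l]
        continuous_on_fip[OF field0] ev0_section h(1))
qed

text \<open>Because the flow is unitary, the images under \<open>U\<^sub>t\<close> of an orthonormal basis of the fibre at \<open>l\<close>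
  form an orthonormal basis for every \<open>t\<close>, so that by Parseval at least one of them pairs with \<open>C v\<close>
  in a way bounded away from zero. For large \<open>t\<close> this forces the corresponding vector of \<open>H\<close> to be
  nonzero at \<open>l\<close>.\<close>

lemma ev_nonzero:
  assumes l: "l \<in> \<Lambda>0"
  shows "\<exists>k\<in>D. ev k l \<noteq> 0"
proof (rule ccontr)
  assume contr: "\<not> (\<exists>k\<in>D. ev k l \<noteq> 0)"
  interpret E: hilbert_fibre "fibre E l" "fip E l" by (rule fibre)
  interpret hilbert_fibre "fibre E0 l" "fip E0 l" by (rule fibre0[OF l])
  define n where "n = cdim (fibre E0 l)"
  obtain h where h: "\<And>i. i < n \<Longrightarrow> h i \<in> D0" "orthonormal n (\<lambda>i. ev0 (h i) l)"
    unfolding n_def using ev0_frame[OF l] by metis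
  obtain v where v: "v \<in> sections E" "v l \<noteq> 0" by (rule nonzero_section)
  have vl: "v l \<in> fibre E l" by (rule section_mem[OF field UNIV_I v(1)])
  have w: "C l (v l) \<in> fibre E0 l" "C l (v l) \<noteq> 0"
    using C_mem[OF l vl] C_nonzero[OF l vl v(2)] by auto
  define q where "q = Re (fip E0 l (C l (v l)) (C l (v l)))"
  have q: "0 < q" "fip E0 l (C l (v l)) (C l (v l)) = of_real q"
    using ip_pos[OF w] ip_self[OF w(1)] by (auto simp: q_def)
  define \<epsilon> where "\<epsilon> = sqrt (q / (n + 1))"
  have \<epsilon>: "0 < \<epsilon>" using q(1) by (simp add: \<epsilon>_def)
  have "\<forall>\<^sub>F t in at_top. \<forall>i\<in>{..<n}. W (U t (h i)) \<in> D \<and> (\<forall>m\<in>{l}. cmod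
    (fip E0 m (C m (v m)) (ev0 (U t (h i)) m) - fip E m (v m) (ev (W (U t (h i))) m)) < \<epsilon>)"
    using l by (intro eventually_ball_finite ballI eventually_conj W_U_mem pairing_close h v(1) \<epsilon>) auto
  from eventually_happens'[OF _ this] obtain t where t: "\<And>i. i < n \<Longrightarrow> W (U t (h i)) \<in> D"
    "\<And>i. i < n \<Longrightarrow> cmod (fip E0 l (C l (v l)) (ev0 (U t (h i)) l) - fip E l (v l) (ev (W (U t (h i))) l)) < \<epsilon>"
    by auto
  have "ev (W (U t (h i))) l = 0" if "i < n" for i using contr t(1)[OF that] by blast
  then have small: "cmod (fip E0 l (C l (v l)) (ev0 (U t (h i)) l)) \<le> \<epsilon>" if "i < n" for i
    using t(2)[OF that] that by (simp add: E.ip_zero_right[OF vl])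
  have "orthonormal n (\<lambda>i. ev0 (U t (h i)) l)"
    using h(2) ev0_mem[OF l U_D0[OF h(1)]] UF_isometry[OF l ev0_mem[OF l h(1)] ev0_mem[OF l h(1)]]
    unfolding orthonormal_def by (simp add: UF_ev0[OF h(1) l])
  from Parseval[OF this n_def w(1)]
  have "of_real q = (\<Sum>i<n. cnj (fip E0 l (C l (v l)) (ev0 (U t (h i)) l)) * fip E0 l (C l (v l)) (ev0 (U t (h i)) l))"
    by (simp add: q(2))
  also have "\<dots> = of_real (\<Sum>i<n. (cmod (fip E0 l (C l (v l)) (ev0 (U t (h i)) l)))\<^sup>2)"
    unfolding of_real_sum by (intro sum.cong refl) (metis complex_norm_square mult.commute of_real_power)
  finally have "q = (\<Sum>i<n. (cmod (fip E0 l (C l (v l)) (ev0 (U t (h i)) l)))\<^sup>2)"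
    by (simp only: of_real_eq_iff)
  also have "\<dots> \<le> (\<Sum>i<n. \<epsilon>\<^sup>2)" using small by (intro sum_mono power_mono) auto
  also have "\<dots> = n * (q / (n + 1))" using q(1) by (simp add: \<epsilon>_def)
  also have "\<dots> < q" using q(1) by (simp add: field_simps)
  finally show False by simp
qed

lemma locally_finite_\<mu>:
  assumes l: "l \<in> \<Lambda>0"
  shows "\<exists>V. open V \<and> l \<in> V \<and> V \<subseteq> \<Lambda>0 \<and> emeasure \<mu> V < \<infinity>"
proof -
  obtain k where k: "k \<in> D" "ev k l \<noteq> 0" using ev_nonzero[OF l] by blast
  have "fip E l (ev k l) (ev k l) \<noteq> 0"
    using hilbert_fibre.ip_pos[OF fibre ev_mem[OF k(1)] k(2)] by auto
  moreover have "sets \<mu> = sets (restrict_space borel UNIV)" by (simp add: sets_\<mu>)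
  ultimately obtain V where V: "open V" "l \<in> V" "emeasure \<mu> V < \<infinity>"
    using finite_measure_near_nonzero[OF open_UNIV _ continuous_on_fip[OF field ev_section[OF k(1)] ev_section[OF k(1)]]
        integrable_ev[OF k(1) k(1)], of l] by blast
  have "emeasure \<mu> (V \<inter> \<Lambda>0) \<le> emeasure \<mu> V"
    using V(1) by (intro emeasure_mono) (auto simp: sets_\<mu>)
  then have "emeasure \<mu> (V \<inter> \<Lambda>0) < \<infinity>" using V(3) by (rule le_less_trans)
  then show ?thesis using V l open_base by (intro exI[of _ "V \<inter> \<Lambda>0"]) auto
qed

end

section \<open>The limit of the pairings\<close>

context asymptotic_containment
begin

text \<open>Uniformity in \<open>t\<close> comes from the unitarity of the flow.\<close>

lemma pairing_bounded:
  assumes h: "h \<in> D0" and v: "v \<in> sections E" and K: "compact K" "K \<subseteq> \<Lambda>0"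
  shows "\<exists>M\<ge>0. \<forall>t. \<forall>l\<in>K. cmod (pairing v t (ev0 h) l) \<le> M"
proof -
  define P where "P l = Re (fip E0 l (C l (v l)) (C l (v l))) * Re (fip E0 l (ev0 h l) (ev0 h l))" for l
  have "continuous_on K P" unfolding P_def
    by (intro continuous_intros continuous_on_subset[OF continuous_on_fip[OF field0] K(2)]
        C_section v ev0_section h)
  then have "bounded (P ` K)" using compact_continuous_image compact_imp_bounded K(1) by blast
  then obtain B where B: "\<And>l. l \<in> K \<Longrightarrow> norm (P l) \<le> B" unfolding bounded_iff by blast
  have "cmod (pairing v t (ev0 h) l) \<le> sqrt (max B 0)" if l: "l \<in> K" for t l
  proof (rule real_le_rsqrt)
    have l0: "l \<in> \<Lambda>0" using K l by blast
    interpret hilbert_fibre "fibre E0 l" "fip E0 l" by (rule fibre0[OF l0])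
    have hl: "ev0 h l \<in> fibre E0 l" by (rule ev0_mem[OF l0 h])
    have "(cmod (pairing v t (ev0 h) l))\<^sup>2 \<le> P l"
      using Cauchy_Schwarz[OF C_mem[OF l0 section_mem[OF field UNIV_I v]] UF_mem[OF l0 hl]]
      by (simp add: pairing_def P_def UF_isometry[OF l0 hl hl])
    also have "\<dots> \<le> max B 0" using B[OF l] by simp
    finally show "(cmod (pairing v t (ev0 h) l))\<^sup>2 \<le> max B 0" .
  qed
  then show ?thesis by (intro exI[of _ "sqrt (max B 0)"]) auto
qed

lemma norm_cnj_mult_diff:
  assumes "cmod (x - x') < \<delta>" "cmod (y - y') < \<delta>" "cmod x \<le> M" "cmod y \<le> M" "\<delta> \<le> 1"
  shows "cmod (cnj x' * y' - cnj x * y) \<le> \<delta> * (2 * M + 1)"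
proof -
  have \<delta>: "0 \<le> \<delta>" and M: "0 \<le> M" using assms norm_ge_zero by (smt (verit))+
  have "cmod y' \<le> M + 1" using norm_triangle_sub[of y' y] assms by (simp add: norm_minus_commute)
  then have "cmod (x' - x) * cmod y' \<le> \<delta> * (M + 1)"
    using assms(1) \<delta> by (intro mult_mono) (auto simp: norm_minus_commute)
  moreover have "cmod x * cmod (y' - y) \<le> M * \<delta>"
    using assms(2,3) M by (intro mult_mono) (auto simp: norm_minus_commute)
  moreover have "cnj x' * y' - cnj x * y = cnj (x' - x) * y' + cnj x * (y' - y)"
    by (simp add: algebra_simps)
  then have "cmod (cnj x' * y' - cnj x * y) \<le> cmod (x' - x) * cmod y' + cmod x * cmod (y' - y)"
    by (metis norm_triangle_ineq norm_mult complex_mod_cnj)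
  ultimately show ?thesis by (simp add: algebra_simps)
qed

text \<open>On a line, \<open>\<langle>k\<^sub>1, k\<^sub>2\<rangle> |v|\<^sup>2\<close> is the product of \<open>\<langle>v, k\<^sub>1\<rangle>\<close> conjugated and \<open>\<langle>v, k\<^sub>2\<rangle>\<close>, and both factors are
  uniformly close to pairings with \<open>C v\<close> on the support of \<open>b\<close>.\<close>

lemma pairing_limit_ev0:
  assumes V: "open V" "V \<subseteq> \<Lambda>0" "emeasure \<mu> V < \<infinity>" and v: "v \<in> sections E"
    and h: "h \<in> D0" and g: "g \<in> D0" and b: "test_function V (b :: 'l \<Rightarrow> complex)"
  shows "((\<lambda>t. \<integral>l. cnj (pairing v t (ev0 h) l) * pairing v t (ev0 g) l * b l \<partial>\<mu>) \<longlongrightarrow>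
    (\<integral>l. fip E0 l (ev0 h l) (ev0 g l) * (fip E l (v l) (v l) * b l) \<partial>\<mu>0)) at_top"
proof -
  obtain K where K: "compact K" "K \<subseteq> V" "\<And>l. l \<notin> K \<Longrightarrow> b l = 0"
    using b unfolding test_function_def by blast
  have K0: "K \<subseteq> \<Lambda>0" using K V by blast
  have borel_\<mu>: "sets \<mu> = sets (restrict_space borel UNIV)" by (simp add: sets_\<mu>)
  have int: "integrable \<mu> (\<lambda>l. f l * b l)" if "continuous_on V f" for f
    by (rule test_function_integrable[OF open_UNIV borel_\<mu> V(1) subset_UNIV V(3)
          test_function_times[OF V(1) that b]])
  have cont: "continuous_on V (\<lambda>l. fip E l (x l) (y l))" if "x \<in> sections E" "y \<in> sections E" for x y
    using continuous_on_fip[OF field that] continuous_on_subset by blast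
  define a where "a l = fip E l (v l) (v l) * b l" for l
  have a: "a \<in> C0"
    unfolding a_def by (rule test_function_C0[OF test_function_times[OF V(1) cont[OF v v] b]])
  define L where "L = (\<integral>l. fip E0 l (ev0 h l) (ev0 g l) * a l \<partial>\<mu>0)"
  define I where "I t = cinner (W (U t h)) (\<pi> a (W (U t g)))" for t
  define J where "J t = (\<integral>l. cnj (pairing v t (ev0 h) l) * pairing v t (ev0 g) l * b l \<partial>\<mu>)" for t
  have "((\<lambda>t. L - I t) \<longlongrightarrow> 0) at_top"
    using containment[unfolded asymptotically_contained_via_def] a cinner0[OF h g a]
    unfolding L_def I_def by metis
  moreover have "((\<lambda>t. I t - J t) \<longlongrightarrow> 0) at_top"
  proof (rule tendstoI)
    fix e :: real assume e: "0 < e"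
    obtain M1 M2 where M1: "M1 \<ge> 0" "\<And>t l. l \<in> K \<Longrightarrow> cmod (pairing v t (ev0 h) l) \<le> M1"
      and M2: "M2 \<ge> 0" "\<And>t l. l \<in> K \<Longrightarrow> cmod (pairing v t (ev0 g) l) \<le> M2"
      using pairing_bounded[OF h v K(1) K0] pairing_bounded[OF g v K(1) K0] by metis
    define M where "M = max M1 M2"
    have M: "0 \<le> M" "\<And>t l. l \<in> K \<Longrightarrow> cmod (pairing v t (ev0 h) l) \<le> M"
      "\<And>t l. l \<in> K \<Longrightarrow> cmod (pairing v t (ev0 g) l) \<le> M"
      using M1 M2 by (auto simp: M_def le_max_iff_disj)
    define N where "N = (\<integral>l. cmod (b l) \<partial>\<mu>)"
    have N: "0 \<le> N" unfolding N_def by simp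
    \<comment> \<open>on \<open>K\<close> the integrands then differ by at most \<open>\<delta> (2 M + 1) |b|\<close>\<close>
    define \<delta> where "\<delta> = min 1 (e / ((2 * M + 1) * (N + 1)))"
    have \<delta>: "0 < \<delta>" "\<delta> \<le> 1" using e M(1) N by (auto simp: \<delta>_def)
    have "\<delta> * (2 * M + 1) * N < \<delta> * (2 * M + 1) * (N + 1)"
      using \<delta>(1) M(1) by (intro mult_strict_left_mono) (auto intro: mult_pos_pos)
    also have "\<delta> \<le> e / ((2 * M + 1) * (N + 1))" by (simp add: \<delta>_def)
    then have "\<delta> * ((2 * M + 1) * (N + 1)) \<le> e"
      using M(1) N by (subst pos_le_divide_eq[symmetric]) (auto intro: mult_pos_pos)
    then have "\<delta> * (2 * M + 1) * (N + 1) \<le> e" by (simp add: mult.assoc)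
    finally have small: "\<delta> * (2 * M + 1) * N < e" .
    have "\<forall>\<^sub>F t in at_top. W (U t h) \<in> D \<and> W (U t g) \<in> D \<and>
      (\<forall>l\<in>K. cmod (fip E0 l (C l (v l)) (ev0 (U t h) l) - fip E l (v l) (ev (W (U t h)) l)) < \<delta>) \<and>
      (\<forall>l\<in>K. cmod (fip E0 l (C l (v l)) (ev0 (U t g) l) - fip E l (v l) (ev (W (U t g)) l)) < \<delta>)"
      by (intro eventually_conj W_U_mem pairing_close h g v K K0 \<delta>)
    then show "\<forall>\<^sub>F t in at_top. dist (I t - J t) 0 < e"
    proof (rule eventually_mono, elim conjE)
      fix t assume k: "W (U t h) \<in> D" "W (U t g) \<in> D"
        and close: "\<forall>l\<in>K. cmod (fip E0 l (C l (v l)) (ev0 (U t h) l) - fip E l (v l) (ev (W (U t h)) l)) < \<delta>"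
        "\<forall>l\<in>K. cmod (fip E0 l (C l (v l)) (ev0 (U t g) l) - fip E l (v l) (ev (W (U t g)) l)) < \<delta>"
      define X where "X l = cnj (fip E l (v l) (ev (W (U t h)) l)) * fip E l (v l) (ev (W (U t g)) l)" for l
      define Y where "Y l = cnj (pairing v t (ev0 h) l) * pairing v t (ev0 g) l" for l
      have contX: "continuous_on V X" unfolding X_def by (intro continuous_intros cont v ev_section k)
      have contY: "continuous_on V Y" unfolding Y_def
        by (intro continuous_intros continuous_pairing V v ev0_local_span h g)
      have "I t = (\<integral>l. fip E l (ev (W (U t h)) l) (ev (W (U t g)) l) * a l \<partial>\<mu>)"
        unfolding I_def by (rule cinner_ev[OF k a])
      also have "\<dots> = (\<integral>l. X l * b l \<partial>\<mu>)"
      proof (rule Bochner_Integration.integral_cong[OF refl])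
        fix l
        have "X l = fip E l (v l) (v l) * fip E l (ev (W (U t h)) l) (ev (W (U t g)) l)"
          unfolding X_def
          by (rule hilbert_fibre.line_ip_product[OF fibre dim_fibre section_mem[OF field UNIV_I v]
                ev_mem[OF k(1)] ev_mem[OF k(2)]])
        then show "fip E l (ev (W (U t h)) l) (ev (W (U t g)) l) * a l = X l * b l"
          by (simp add: a_def)
      qed
      finally have "I t - J t = (\<integral>l. X l * b l - Y l * b l \<partial>\<mu>)"
        unfolding J_def Y_def[symmetric]
        by (simp add: Bochner_Integration.integral_diff[OF int[OF contX] int[OF contY]])
      then have "cmod (I t - J t) \<le> (\<integral>l. cmod (X l * b l - Y l * b l) \<partial>\<mu>)" by simp
      also have "\<dots> \<le> (\<integral>l. \<delta> * (2 * M + 1) * cmod (b l) \<partial>\<mu>)"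
      proof (rule integral_mono)
        show "integrable \<mu> (\<lambda>l. cmod (X l * b l - Y l * b l))"
          using int[OF contX] int[OF contY] by (intro integrable_norm Bochner_Integration.integrable_diff)
        show "integrable \<mu> (\<lambda>l. \<delta> * (2 * M + 1) * cmod (b l))"
          using int[of "\<lambda>_. 1"] by (intro integrable_mult_right integrable_norm) simp
        fix l
        show "cmod (X l * b l - Y l * b l) \<le> \<delta> * (2 * M + 1) * cmod (b l)"
        proof (cases "l \<in> K")
          case False
          then show ?thesis by (simp add: K(3))
        next
          case l: True
          then have l0: "l \<in> \<Lambda>0" using K0 by blast
          have "cmod (X l - Y l) \<le> \<delta> * (2 * M + 1)"
            unfolding X_def Y_def
          proof (rule norm_cnj_mult_diff[OF _ _ M(2)[OF l] M(3)[OF l] \<delta>(2)])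
            show "cmod (pairing v t (ev0 h) l - fip E l (v l) (ev (W (U t h)) l)) < \<delta>"
              using close(1) l by (simp add: pairing_def UF_ev0[OF h l0])
            show "cmod (pairing v t (ev0 g) l - fip E l (v l) (ev (W (U t g)) l)) < \<delta>"
              using close(2) l by (simp add: pairing_def UF_ev0[OF g l0])
          qed
          then have "cmod (X l - Y l) * cmod (b l) \<le> \<delta> * (2 * M + 1) * cmod (b l)"
            by (rule mult_right_mono) simp
          then show ?thesis by (simp only: left_diff_distrib[symmetric] norm_mult)
        qed
      qed
      also have "\<dots> = \<delta> * (2 * M + 1) * N" by (simp add: N_def)
      also note small
      finally show "dist (I t - J t) 0 < e" by (simp add: dist_norm)
    qed
  qed
  ultimately have "((\<lambda>t. (L - I t) + (I t - J t)) \<longlongrightarrow> 0 + 0) at_top" by (rule tendsto_add)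
  then have "((\<lambda>t. L - (L - J t)) \<longlongrightarrow> L - 0) at_top" by (intro tendsto_diff tendsto_const) simp
  then show ?thesis by (simp add: J_def L_def a_def)
qed

text \<open>The continuous coefficients of \<open>s\<close> and \<open>s'\<close> are absorbed into the test function, which is why
  the induction is over all \<open>b\<close>.\<close>

lemma pairing_limit:
  assumes V: "open V" "V \<subseteq> \<Lambda>0" "emeasure \<mu> V < \<infinity>" "emeasure \<mu>0 V < \<infinity>" and v: "v \<in> sections E"
    and s: "s \<in> LS V" and s': "s' \<in> LS V" and b: "test_function V (b :: 'l \<Rightarrow> complex)"
  shows "((\<lambda>t. \<integral>l. cnj (pairing v t s l) * pairing v t s' l * b l \<partial>\<mu>) \<longlongrightarrow>
    (\<integral>l. fip E0 l (s l) (s' l) * (fip E l (v l) (v l) * b l) \<partial>\<mu>0)) at_top"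
proof -
  have borel_\<mu>: "sets \<mu> = sets (restrict_space borel UNIV)" by (simp add: sets_\<mu>)
  have int: "integrable \<mu> (\<lambda>l. cnj (pairing v t r l) * pairing v t r' l * b l)"
    if "r \<in> LS V" "r' \<in> LS V" "test_function V b" for r r' b t
    using that(1,2)
    by (intro test_function_integrable[OF open_UNIV borel_\<mu> V(1) subset_UNIV V(3)]
        test_function_times[OF V(1) _ that(3)] continuous_intros continuous_pairing V(2) v)
  have int0: "integrable \<mu>0 (\<lambda>l. fip E0 l (r l) (r' l) * (fip E l (v l) (v l) * b l))"
    if "r \<in> LS V" "r' \<in> LS V" "test_function V b" for r r' b
    using that(1,2)
    by (intro test_function_integrable[OF open_base sets_\<mu>0 V(1,2,4)]
        test_function_times[OF V(1)] that(3) continuous_fip_local_span V(2)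
        continuous_on_subset[OF continuous_on_fip[OF field v v]]) simp_all
  have vl: "v l \<in> fibre E l" for l by (rule section_mem[OF field UNIV_I v])
  have outside: "b l = 0" if "test_function V b" "l \<notin> V" for b :: "'l \<Rightarrow> complex" and l
    by (rule test_function_outside[OF that])
  have one: "((\<lambda>t. \<integral>l. cnj (pairing v t (ev0 h) l) * pairing v t s' l * b l \<partial>\<mu>) \<longlongrightarrow>
    (\<integral>l. fip E0 l (ev0 h l) (s' l) * (fip E l (v l) (v l) * b l) \<partial>\<mu>0)) at_top"
    if h: "h \<in> D0" and b: "test_function V b" for h b
    using s' b
  proof (induction arbitrary: b rule: local_span.induct)
    case (multiple g c)
    have b': "test_function V (\<lambda>l. c l * b l)"
      by (rule test_function_times[OF V(1) multiple(2,3)])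
    have eq: "cnj (pairing v t (ev0 h) l) * pairing v t (ev0 g) l * (c l * b l)
      = cnj (pairing v t (ev0 h) l) * pairing v t (\<lambda>l. c l *\<^sub>C ev0 g l) l * b l" for t l
    proof (cases "l \<in> V")
      case True
      then have l: "l \<in> \<Lambda>0" using V by blast
      show ?thesis
        using pairing_scale[where s="ev0 g" and v=v and c=c, OF l vl ev0_mem[OF l multiple(1)]] by simp
    qed (simp add: outside[OF multiple(3)])
    have eq0: "fip E0 l (ev0 h l) (ev0 g l) * (fip E l (v l) (v l) * (c l * b l))
      = fip E0 l (ev0 h l) (c l *\<^sub>C ev0 g l) * (fip E l (v l) (v l) * b l)" for l
    proof (cases "l \<in> V")
      case True
      then have l: "l \<in> \<Lambda>0" using V by blast
      show ?thesis
        using hilbert_fibre.ip_scale_right[OF fibre0[OF l] ev0_mem[OF l h] ev0_mem[OF l multiple(1)]] by simp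
    qed (simp add: outside[OF multiple(3)])
    show ?case
      using pairing_limit_ev0[OF V(1-3) v h multiple(1) b'] by (simp only: eq eq0)
  next
    case (add r r')
    have "cnj (pairing v t (ev0 h) l) * pairing v t (\<lambda>l. r l + r' l) l * b l =
      cnj (pairing v t (ev0 h) l) * pairing v t r l * b l +
      cnj (pairing v t (ev0 h) l) * pairing v t r' l * b l" for t l
    proof (cases "l \<in> V")
      case True
      then have l: "l \<in> \<Lambda>0" using V by blast
      show ?thesis
        using pairing_add[where s=r and s'=r' and v=v, OF l vl local_span_mem[OF add(1) l] local_span_mem[OF add(2) l]]
        by (simp add: algebra_simps)
    qed (simp add: outside[OF add(5)])
    moreover have "fip E0 l (ev0 h l) (r l + r' l) * (fip E l (v l) (v l) * b l) =
      fip E0 l (ev0 h l) (r l) * (fip E l (v l) (v l) * b l) +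
      fip E0 l (ev0 h l) (r' l) * (fip E l (v l) (v l) * b l)" for l
    proof (cases "l \<in> V")
      case True
      then have l: "l \<in> \<Lambda>0" using V by blast
      show ?thesis
        using hilbert_fibre.ip_add_right[OF fibre0[OF l] ev0_mem[OF l h] local_span_mem[OF add(1) l] local_span_mem[OF add(2) l]]
        by (simp add: algebra_simps)
    qed (simp add: outside[OF add(5)])
    ultimately show ?case
      using tendsto_add[OF add.IH(1)[OF add(5)] add.IH(2)[OF add(5)]]
      by (simp add: Bochner_Integration.integral_add int int0 add(1,2,5) ev0_local_span h)
  qed
  show ?thesis
    using s b
  proof (induction arbitrary: b rule: local_span.induct)
    case (multiple h c)
    have b': "test_function V (\<lambda>l. cnj (c l) * b l)"
      using multiple(2,3) by (intro test_function_times[OF V(1)] continuous_intros)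
    have eq: "cnj (pairing v t (ev0 h) l) * pairing v t s' l * (cnj (c l) * b l)
      = cnj (pairing v t (\<lambda>l. c l *\<^sub>C ev0 h l) l) * pairing v t s' l * b l" for t l
    proof (cases "l \<in> V")
      case True
      then have l: "l \<in> \<Lambda>0" using V by blast
      show ?thesis
        using pairing_scale[where s="ev0 h" and v=v and c=c, OF l vl ev0_mem[OF l multiple(1)]] by simp
    qed (simp add: outside[OF multiple(3)])
    have eq0: "fip E0 l (ev0 h l) (s' l) * (fip E l (v l) (v l) * (cnj (c l) * b l))
      = fip E0 l (c l *\<^sub>C ev0 h l) (s' l) * (fip E l (v l) (v l) * b l)" for l
    proof (cases "l \<in> V")
      case True
      then have l: "l \<in> \<Lambda>0" using V by blast
      show ?thesis
        using hilbert_fibre.ip_scale_left[OF fibre0[OF l] ev0_mem[OF l multiple(1)] local_span_mem[OF s' l]] by simp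
    qed (simp add: outside[OF multiple(3)])
    show ?case using one[OF multiple(1) b'] by (simp only: eq eq0)
  next
    case (add r r')
    have "cnj (pairing v t (\<lambda>l. r l + r' l) l) * pairing v t s' l * b l =
      cnj (pairing v t r l) * pairing v t s' l * b l +
      cnj (pairing v t r' l) * pairing v t s' l * b l" for t l
    proof (cases "l \<in> V")
      case True
      then have l: "l \<in> \<Lambda>0" using V by blast
      show ?thesis
        using pairing_add[where s=r and s'=r' and v=v, OF l vl local_span_mem[OF add(1) l] local_span_mem[OF add(2) l]]
        by (simp add: algebra_simps)
    qed (simp add: outside[OF add(5)])
    moreover have "fip E0 l (r l + r' l) (s' l) * (fip E l (v l) (v l) * b l) =
      fip E0 l (r l) (s' l) * (fip E l (v l) (v l) * b l) +
      fip E0 l (r' l) (s' l) * (fip E l (v l) (v l) * b l)" for l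
    proof (cases "l \<in> V")
      case True
      then have l: "l \<in> \<Lambda>0" using V by blast
      show ?thesis
        using hilbert_fibre.ip_add_left[OF fibre0[OF l] local_span_mem[OF add(1) l] local_span_mem[OF add(2) l] local_span_mem[OF s' l]]
        by (simp add: algebra_simps)
    qed (simp add: outside[OF add(5)])
    ultimately show ?case
      using tendsto_add[OF add.IH(1)[OF add(5)] add.IH(2)[OF add(5)]]
      by (simp add: Bochner_Integration.integral_add int int0 add(1,2,5) s')
  qed
qed

section \<open>The trace formula\<close>

lemma trace_density_eq:
  assumes l: "l \<in> \<Lambda>0" and v: "v \<in> fibre E l" "v \<noteq> 0"
  shows "complex_of_real (trace_density E E0 C l) =
    fip E0 l (C l v) (C l v) / (fip E l v v * of_nat (cdim (fibre E0 l)))"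
proof -
  have "ctrace (fibre E l) (fibre_adjoint (fibre E l) (fip E l) (fip E0 l) (C l) \<circ> C l)
      = fip E0 l (C l v) (C l v) / fip E l v v"
    by (rule ctrace_fibre_adjoint_line[OF fibre fibre0[OF l] dim_fibre C_linear[OF l] C_image[OF l] v])
  moreover have "fip E0 l (C l v) (C l v) = of_real (Re (fip E0 l (C l v) (C l v)))"
    by (rule hilbert_fibre.ip_self[OF fibre0[OF l] C_mem[OF l v(1)]])
  moreover have "fip E l v v = of_real (Re (fip E l v v))"
    by (rule hilbert_fibre.ip_self[OF fibre v(1)])
  ultimately have "ctrace (fibre E l) (fibre_adjoint (fibre E l) (fip E l) (fip E0 l) (C l) \<circ> C l)
      = of_real (Re (fip E0 l (C l v) (C l v)) / Re (fip E l v v))"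
    and *: "fip E0 l (C l v) (C l v) / fip E l v v
      = of_real (Re (fip E0 l (C l v) (C l v)) / Re (fip E l v v))"
    by (metis of_real_divide)+
  then show ?thesis
    unfolding trace_density_def divide_divide_eq_left[symmetric] * by simp
qed

lemma trace_density_nonneg:
  assumes l: "l \<in> \<Lambda>0"
  shows "0 \<le> trace_density E E0 C l"
proof -
  obtain v where v: "v \<in> sections E" "v l \<noteq> 0" by (rule nonzero_section)
  have vl: "v l \<in> fibre E l" by (rule section_mem[OF field UNIV_I v(1)])
  have "complex_of_real (trace_density E E0 C l) = of_real (Re (fip E0 l (C l (v l)) (C l (v l)))
      / (Re (fip E l (v l) (v l)) * real (cdim (fibre E0 l))))"
    unfolding trace_density_eq[OF l vl v(2)] of_real_divide of_real_mult of_real_of_nat_eq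
      hilbert_fibre.ip_self[OF fibre0[OF l] C_mem[OF l vl], symmetric]
      hilbert_fibre.ip_self[OF fibre vl, symmetric] by (rule refl)
  then have "trace_density E E0 C l = Re (fip E0 l (C l (v l)) (C l (v l)))
      / (Re (fip E l (v l) (v l)) * real (cdim (fibre E0 l)))"
    by (simp only: of_real_eq_iff)
  then show ?thesis
    using hilbert_fibre.ip_self_nonneg[OF fibre0[OF l] C_mem[OF l vl]]
      hilbert_fibre.ip_self_nonneg[OF fibre vl] by simp
qed

text \<open>The pairings with the members of the orthonormal frame are squared and summed: by Parseval
  the sum is \<open>|C v|\<^sup>2\<close> at every time, so the limit in \<open>t\<close> is an identity of integrals.\<close>

lemma local_trace_formula:
  assumes l0: "l0 \<in> \<Lambda>0"
  shows "\<exists>V. open V \<and> l0 \<in> V \<and> V \<subseteq> \<Lambda>0 \<and> emeasure \<mu> V < \<infinity> \<and> emeasure \<mu>0 V < \<infinity> \<and>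
    continuous_on V (trace_density E E0 C) \<and>
    (\<forall>f :: 'l \<Rightarrow> real. test_function V f \<longrightarrow>
      (\<integral>l. trace_density E E0 C l * f l \<partial>\<mu>) = (\<integral>l. f l \<partial>\<mu>0))"
proof -
  define n where "n = cdim (fibre E0 l0)"
  interpret l0: hilbert_fibre "fibre E0 l0" "fip E0 l0" by (rule fibre0[OF l0])
  obtain V1 h where V1: "open V1" "l0 \<in> V1" "\<And>m. m \<in> V1 \<Longrightarrow> cdim (fibre E0 m) = n"
    and h: "\<And>i. i < n \<Longrightarrow> h i \<in> D0" "l0.orthonormal n (\<lambda>i. ev0 (h i) l0)"
    unfolding n_def using ev0_frame[OF l0] by metis
  obtain V2 u where V2: "open V2" "l0 \<in> V2" "V2 \<subseteq> \<Lambda>0" and u2: "\<And>i. i < n \<Longrightarrow> u i \<in> LS V2"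
    and on: "\<And>l. l \<in> V2 \<Longrightarrow> hilbert_fibre.orthonormal (fibre E0 l) (fip E0 l) n (\<lambda>i. u i l)"
    using local_Gram_Schmidt[where h=h, OF l0 h] by blast
  obtain v where v: "v \<in> sections E" "v l0 \<noteq> 0" by (rule nonzero_section)
  have vl: "v l \<in> fibre E l" for l by (rule section_mem[OF field UNIV_I v(1)])
  define nv where "nv l = fip E l (v l) (v l)" for l
  have nv_cont: "continuous_on UNIV nv" unfolding nv_def by (rule continuous_on_fip[OF field v(1) v(1)])
  have nv_zero: "nv l = 0 \<longleftrightarrow> v l = 0" for l
    using hilbert_fibre.ip_pos[OF fibre vl[of l]] hilbert_fibre.ip_zero_right[OF fibre vl[of l]]
    by (cases "v l = 0") (auto simp: nv_def)
  define V3 where "V3 = nv -` (- {0})"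
  have V3: "open V3" "l0 \<in> V3"
    using nv_cont v(2) by (auto simp: V3_def nv_zero continuous_on_open_vimage intro!: open_vimage)
  have Cl0: "C l0 (v l0) \<in> fibre E0 l0" "C l0 (v l0) \<noteq> 0"
    by (rule C_mem[OF l0 vl], rule C_nonzero[OF l0 vl v(2)])
  have n: "0 < n"
  proof (rule ccontr)
    assume "\<not> 0 < n"
    then show False using l0.orthonormal_expansion[OF h(2) n_def Cl0(1)] Cl0(2) by simp
  qed
  obtain V4 where V4: "open V4" "l0 \<in> V4" "V4 \<subseteq> \<Lambda>0" "emeasure \<mu> V4 < \<infinity>"
    using locally_finite_\<mu>[OF l0] by blast
  obtain V5 where V5: "open V5" "l0 \<in> V5" "V5 \<subseteq> \<Lambda>0" "emeasure \<mu>0 V5 < \<infinity>"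
    using locally_finite_\<mu>0[OF l0] n unfolding n_def by blast
  define V where "V = V1 \<inter> V2 \<inter> V3 \<inter> V4 \<inter> V5"
  have V: "open V" "l0 \<in> V" "V \<subseteq> \<Lambda>0" using V1 V2 V3 V4 V5 by (auto simp: V_def)
  have "emeasure \<mu> V \<le> emeasure \<mu> V4" using V4(1) by (intro emeasure_mono) (auto simp: V_def sets_\<mu>)
  then have fin: "emeasure \<mu> V < \<infinity>" using V4(4) by (rule le_less_trans)
  have "emeasure \<mu>0 V \<le> emeasure \<mu>0 V5"
    using open_sets_restrict_space_borel[OF open_base sets_\<mu>0 V5(1,3)]
    by (intro emeasure_mono) (auto simp: V_def)
  then have fin0: "emeasure \<mu>0 V < \<infinity>" using V5(4) by (rule le_less_trans)
  have u: "u i \<in> LS V" if "i < n" for i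
    by (rule local_span_mono[OF _ u2[OF that]]) (auto simp: V_def)
  have nv_V: "nv l \<noteq> 0" if "l \<in> V" for l using that by (simp add: V_def V3_def)
  have density: "complex_of_real (trace_density E E0 C l) =
      fip E0 l (C l (v l)) (C l (v l)) / (nv l * of_nat n)" if "l \<in> V" for l
    using trace_density_eq[of l "v l"] vl that V1(3)[of l] V(3) nv_V[OF that] nv_zero[of l]
    by (auto simp: nv_def V_def)
  have C_cont: "continuous_on V (\<lambda>l. fip E0 l (C l (v l)) (C l (v l)))"
    by (rule continuous_on_subset[OF continuous_on_fip[OF field0 C_section[OF v(1)] C_section[OF v(1)]] V(3)])
  have nv_cont_V: "continuous_on V nv" using nv_cont continuous_on_subset by blast
  have "continuous_on V (\<lambda>l. Re (fip E0 l (C l (v l)) (C l (v l)) / (nv l * of_nat n)))"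
    using n nv_V by (intro continuous_intros C_cont nv_cont_V) auto
  then have cont: "continuous_on V (trace_density E E0 C)"
    by (rule continuous_on_eq) (simp add: density[symmetric])
  have "(\<integral>l. trace_density E E0 C l * f l \<partial>\<mu>) = (\<integral>l. f l \<partial>\<mu>0)"
    if f: "test_function V f" for f :: "'l \<Rightarrow> real"
  proof -
    \<comment> \<open>the weight cancels the factor \<open>|v|\<^sup>2\<close> of the limit formula and the number of frame members\<close>
    define b where "b l = inverse (nv l * of_nat n) * complex_of_real (f l)" for l
    have b: "test_function V b" unfolding b_def
      using n nv_V
      by (intro test_function_times[OF V(1)] test_function_of_real f continuous_intros nv_cont_V) auto
    have fV: "f l = 0" if "l \<notin> V" for l by (rule test_function_outside[OF f that])
    have borel_\<mu>: "sets \<mu> = sets (restrict_space borel UNIV)" by (simp add: sets_\<mu>)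
    have int: "integrable \<mu> (\<lambda>l. cnj (pairing v t (u i) l) * pairing v t (u i) l * b l)" if "i < n" for t i
      using u[OF that]
      by (intro test_function_integrable[OF open_UNIV borel_\<mu> V(1) subset_UNIV fin]
          test_function_times[OF V(1) _ b] continuous_intros continuous_pairing V(3) v)
    have "((\<lambda>t. \<Sum>i<n. \<integral>l. cnj (pairing v t (u i) l) * pairing v t (u i) l * b l \<partial>\<mu>) \<longlongrightarrow>
      (\<Sum>i<n. \<integral>l. fip E0 l (u i l) (u i l) * (fip E l (v l) (v l) * b l) \<partial>\<mu>0)) at_top"
      by (intro tendsto_sum pairing_limit[OF V(1,3) fin fin0 v(1) _ _ b] u) auto
    moreover have "(\<Sum>i<n. \<integral>l. cnj (pairing v t (u i) l) * pairing v t (u i) l * b l \<partial>\<mu>)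
      = (\<integral>l. complex_of_real (trace_density E E0 C l * f l) \<partial>\<mu>)" for t
    proof -
      have "(\<Sum>i<n. \<integral>l. cnj (pairing v t (u i) l) * pairing v t (u i) l * b l \<partial>\<mu>)
        = (\<integral>l. (\<Sum>i<n. cnj (pairing v t (u i) l) * pairing v t (u i) l * b l) \<partial>\<mu>)"
        using int by (intro Bochner_Integration.integral_sum[symmetric]) auto
      also have "\<dots> = (\<integral>l. complex_of_real (trace_density E E0 C l * f l) \<partial>\<mu>)"
      proof (rule Bochner_Integration.integral_cong[OF refl])
        fix l
        show "(\<Sum>i<n. cnj (pairing v t (u i) l) * pairing v t (u i) l * b l)
          = complex_of_real (trace_density E E0 C l * f l)"
        proof (cases "l \<in> V")
          case False
          then show ?thesis by (simp add: b_def fV)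
        next
          case lV: True
          then have l: "l \<in> \<Lambda>0" and dim: "cdim (fibre E0 l) = n" and l2: "l \<in> V2"
            using V(3) V1(3) by (auto simp: V_def)
          interpret hilbert_fibre "fibre E0 l" "fip E0 l" by (rule fibre0[OF l])
          have ul: "u i l \<in> fibre E0 l" if "i < n" for i
            by (rule local_span_mem[OF u[OF that] l])
          have "orthonormal n (\<lambda>i. UF t l (u i l))"
            using on[OF l2] unfolding orthonormal_def by (simp add: UF_mem[OF l ul] UF_isometry[OF l ul ul])
          from Parseval[OF this dim[symmetric] C_mem[OF l vl]]
          have "(\<Sum>i<n. cnj (pairing v t (u i) l) * pairing v t (u i) l) = fip E0 l (C l (v l)) (C l (v l))"
            by (simp add: pairing_def)
          then have "(\<Sum>i<n. cnj (pairing v t (u i) l) * pairing v t (u i) l * b l)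
            = fip E0 l (C l (v l)) (C l (v l)) * b l"
            by (simp add: sum_distrib_right[symmetric])
          then show ?thesis by (simp add: b_def density[OF lV] divide_inverse)
        qed
      qed
      finally show ?thesis .
    qed
    ultimately have "(\<integral>l. complex_of_real (trace_density E E0 C l * f l) \<partial>\<mu>) =
      (\<Sum>i<n. \<integral>l. fip E0 l (u i l) (u i l) * (fip E l (v l) (v l) * b l) \<partial>\<mu>0)"
      by (simp add: tendsto_const_iff)
    also have "\<dots> = (\<Sum>i<n. \<integral>l. complex_of_real (f l / n) \<partial>\<mu>0)"
    proof (intro sum.cong refl Bochner_Integration.integral_cong)
      fix i l assume i: "i \<in> {..<n}"
      show "fip E0 l (u i l) (u i l) * (fip E l (v l) (v l) * b l) = complex_of_real (f l / n)"
      proof (cases "l \<in> V")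
        case False
        then show ?thesis by (simp add: b_def fV)
      next
        case lV: True
        then have l: "l \<in> \<Lambda>0" and l2: "l \<in> V2" using V(3) by (auto simp: V_def)
        have "fip E0 l (u i l) (u i l) = 1"
          using on[OF l2] i hilbert_fibre.orthonormal_def[OF fibre0[OF l]] by auto
        then show ?thesis using nv_V[OF lV] n by (simp add: b_def nv_def[symmetric] field_simps)
      qed
    qed
    also have "\<dots> = complex_of_real (\<integral>l. f l \<partial>\<mu>0)"
      unfolding integral_complex_of_real using n by simp
    finally show ?thesis unfolding integral_complex_of_real of_real_eq_iff .
  qed
  then show ?thesis using V fin fin0 cont by blast
qed

end

theorem theorem2p6:
  fixes \<pi> :: "('l::t2_space \<Rightarrow> complex) \<Rightarrow> 'h::chilbert_space \<Rightarrow> 'h"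
    and \<pi>0 :: "('l \<Rightarrow> complex) \<Rightarrow> 'h0::chilbert_space \<Rightarrow> 'h0"
    and U :: "real \<Rightarrow> 'h0 \<Rightarrow> 'h0"
    and W :: "'h0 \<Rightarrow> 'h"
    and \<Lambda>0 :: "'l set"
    and E0 :: "('l, 'e::complex_vector) hfield"
    and D0 :: "'h0 set"
    and ev0 :: "'h0 \<Rightarrow> 'l \<Rightarrow> 'e"
    and \<mu>0 :: "'l measure"
    and UF :: "real \<Rightarrow> 'l \<Rightarrow> 'e \<Rightarrow> 'e"
    and E :: "('l, 'f::complex_vector) hfield"
    and D :: "'h set"
    and ev :: "'h \<Rightarrow> 'l \<Rightarrow> 'f"
    and \<mu> :: "'l measure"
    and C :: "'l \<Rightarrow> 'f \<Rightarrow> 'e"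
  assumes "locally_compact_space (euclidean :: 'l topology)"
    and "separable_C0 TYPE('l)"
    and "separable_space (euclidean :: 'h topology)"
    and "separable_space (euclidean :: 'h0 topology)"
    and "representation_C0 \<pi>" and "nondegenerate \<pi>"
    and "representation_C0 \<pi>0" and "nondegenerate \<pi>0"
    and "asymptotically_contained_via \<pi>0 \<pi> U W"
    and "assumption_A \<pi>0 \<Lambda>0 E0 D0 ev0 \<mu>0"
    and "assumption_B U \<Lambda>0 E0 D0 ev0 UF"
    and "assumption_C \<pi> U W D0 E D ev \<mu>"
    and "assumption_D U W \<Lambda>0 E0 D0 ev0 E ev C"
  shows "absolutely_continuous (restrict_space \<mu> \<Lambda>0) \<mu>0 \<and>
    (\<lambda>l. ennreal (trace_density E E0 C l)) \<in> borel_measurable (restrict_space \<mu> \<Lambda>0) \<and>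
    density (restrict_space \<mu> \<Lambda>0) (\<lambda>l. ennreal (trace_density E E0 C l)) = \<mu>0 \<and>
    (AE l in restrict_space \<mu> \<Lambda>0. RN_deriv (restrict_space \<mu> \<Lambda>0) \<mu>0 l = ennreal (trace_density E E0 C l))"
proof -
  interpret asymptotic_containment \<pi> \<pi>0 U W \<Lambda>0 E0 D0 ev0 \<mu>0 UF E D ev \<mu> C
    by (rule asymptotic_containment.intro) fact+
  define \<rho> where "\<rho> = trace_density E E0 C"
  define \<mu>' where "\<mu>' = restrict_space \<mu> \<Lambda>0"
  note local = local_trace_formula[folded \<rho>_def]
  have sets': "sets \<mu>' = sets (restrict_space borel \<Lambda>0)"
    unfolding \<mu>'_def by (rule sets_restrict_space_cong[OF sets_\<mu>])
  have base: "\<Lambda>0 \<in> sets \<mu>" using open_base by (simp add: sets_\<mu>)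
  have emeasure': "emeasure \<mu>' V = emeasure \<mu> V" if "V \<subseteq> \<Lambda>0" for V
    unfolding \<mu>'_def using base that by (intro emeasure_restrict_space) auto
  have "isCont \<rho> l" if l: "l \<in> \<Lambda>0" for l
  proof -
    obtain V where "open V" "l \<in> V" "continuous_on V \<rho>" using local[OF l] by blast
    then show ?thesis by (simp add: continuous_on_eq_continuous_at)
  qed
  then have "continuous_on \<Lambda>0 \<rho>" by (intro continuous_at_imp_continuous_on) blast
  then have "\<rho> \<in> borel_measurable (restrict_space borel \<Lambda>0)"
    by (rule borel_measurable_continuous_on_restrict)
  then have meas\<rho>: "\<rho> \<in> borel_measurable \<mu>'"
    by (simp add: measurable_cong_sets[OF sets' refl])
  then have meas: "(\<lambda>l. ennreal (\<rho> l)) \<in> borel_measurable \<mu>'" by measurable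
  have "\<mu>0 = density \<mu>' (\<lambda>l. ennreal (\<rho> l))"
  proof (rule measure_eqI_test_functions[OF assms(1,2) open_base sets_\<mu>0])
    show "sets (density \<mu>' (\<lambda>l. ennreal (\<rho> l))) = sets (restrict_space borel \<Lambda>0)"
      by (simp add: sets')
    fix l assume "l \<in> \<Lambda>0"
    then obtain V where V: "open V" "l \<in> V" "V \<subseteq> \<Lambda>0" "emeasure \<mu> V < \<infinity>" "emeasure \<mu>0 V < \<infinity>"
      "continuous_on V \<rho>"
      and eq: "\<And>f :: 'l \<Rightarrow> real. test_function V f \<Longrightarrow> (\<integral>l. \<rho> l * f l \<partial>\<mu>) = (\<integral>l. f l \<partial>\<mu>0)"
      using local by blast
    have "(\<integral>\<^sup>+y. ennreal (f y) \<partial>\<mu>0) = (\<integral>\<^sup>+y. ennreal (f y) \<partial>density \<mu>' (\<lambda>l. ennreal (\<rho> l)))"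
      if f: "test_function V f" "\<forall>y. 0 \<le> f y" for f :: "'l \<Rightarrow> real"
    proof -
      have measf: "f \<in> borel_measurable \<mu>'"
        using borel_measurable_continuous_onI[OF test_function_continuous[OF f(1)]]
        by (simp add: measurable_cong_sets[OF sets' refl] measurable_restrict_space1)
      have borel_\<mu>: "sets \<mu> = sets (restrict_space borel UNIV)" by (simp add: sets_\<mu>)
      have fV: "f y = 0" if "y \<notin> V" for y by (rule test_function_outside[OF f(1) that])
      have nonneg: "0 \<le> \<rho> y * f y" for y
        using trace_density_nonneg[of y] V(3) fV[of y] f(2) by (cases "y \<in> V") (auto simp: \<rho>_def)
      have "(\<integral>\<^sup>+y. ennreal (f y) \<partial>density \<mu>' (\<lambda>l. ennreal (\<rho> l)))
          = (\<integral>\<^sup>+y. ennreal (\<rho> y) * ennreal (f y) \<partial>\<mu>')"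
        using measf by (intro nn_integral_density meas) measurable
      also have "\<dots> = (\<integral>\<^sup>+y. ennreal (\<rho> y) * ennreal (f y) * indicator \<Lambda>0 y \<partial>\<mu>)"
        unfolding \<mu>'_def using base by (intro nn_integral_restrict_space) simp
      also have "\<dots> = (\<integral>\<^sup>+y. ennreal (\<rho> y * f y) \<partial>\<mu>)"
      proof (rule nn_integral_cong)
        fix y show "ennreal (\<rho> y) * ennreal (f y) * indicator \<Lambda>0 y = ennreal (\<rho> y * f y)"
          using trace_density_nonneg[of y] V(3) fV[of y] f(2)
          by (cases "y \<in> V") (auto simp: \<rho>_def ennreal_mult)
      qed
      also have "\<dots> = ennreal (\<integral>y. \<rho> y * f y \<partial>\<mu>)"
        by (intro nn_integral_eq_integral AE_I2 nonneg
            test_function_integrable[OF open_UNIV borel_\<mu> V(1) subset_UNIV V(4)]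
            test_function_times[OF V(1,6) f(1)])
      also have "\<dots> = ennreal (\<integral>y. f y \<partial>\<mu>0)" by (simp add: eq[OF f(1)])
      also have "\<dots> = (\<integral>\<^sup>+y. ennreal (f y) \<partial>\<mu>0)"
        using f(2)
        by (intro nn_integral_eq_integral[symmetric] AE_I2
            test_function_integrable[OF open_base sets_\<mu>0 V(1,3,5) f(1)]) auto
      finally show ?thesis by simp
    qed
    then show "\<exists>V. open V \<and> l \<in> V \<and> V \<subseteq> \<Lambda>0 \<and> emeasure \<mu>0 V < \<infinity> \<and>
      (\<forall>f :: 'l \<Rightarrow> real. test_function V f \<longrightarrow> (\<forall>y. 0 \<le> f y) \<longrightarrow>
        (\<integral>\<^sup>+y. ennreal (f y) \<partial>\<mu>0) = (\<integral>\<^sup>+y. ennreal (f y) \<partial>density \<mu>' (\<lambda>l. ennreal (\<rho> l))))"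
      using V by blast
  qed
  then have eq: "density \<mu>' (\<lambda>l. ennreal (\<rho> l)) = \<mu>0" by (rule sym)
  have "sigma_finite_measure \<mu>'"
  proof (rule sigma_finite_of_locally_finite[OF assms(1,2) open_base sets'])
    fix l assume "l \<in> \<Lambda>0"
    then obtain V where "open V" "l \<in> V" "V \<subseteq> \<Lambda>0" "emeasure \<mu> V < \<infinity>"
      using locally_finite_\<mu> by blast
    then show "\<exists>V. open V \<and> l \<in> V \<and> V \<subseteq> \<Lambda>0 \<and> emeasure \<mu>' V < \<infinity>"
      using emeasure' by auto
  qed
  from sigma_finite_measure.RN_deriv_unique[OF this meas eq]
  have "AE l in \<mu>'. RN_deriv \<mu>' \<mu>0 l = ennreal (\<rho> l)" by (auto elim: eventually_mono)
  moreover have "absolutely_continuous \<mu>' \<mu>0"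
    using absolutely_continuousI_density[OF meas] by (simp only: eq)
  ultimately show ?thesis using meas eq unfolding \<rho>_def \<mu>'_def by blast
qed

end
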